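(* Let $(M,d)$ be a Polish (separable and complete) geodesic space with curvature lower bounded by some $\kappa\in\mathbb{R}$ in the sense of Alexandrov. Let $\mu\in\mathcal{P}_2(M)$ and suppose that $\mu$ admits a barycenter $x^*\in M$. Let $\alpha\in\mathbb{R}$ and let $f:M\to\mathbb{R}$ be geodesically $\alpha$-convex and locally Lipschitz at $x^*$. Then if $f$ is either positive, or in $L^1(\mu)$, we have \[ f(x^* )\le \int_M f\,\mathrm{d}\mu-\frac{\alpha}{2}\mathcal{V}^*_{\mu}. \]
   Context: **Geodesic spaces.** Let $(M,d)$ be a metric space. The length of a path (continuous map) $\gamma:I\to M$, with $I\subset\mathbb{R}$ an interval, is $L(\gamma):=\sup\sum_{i=0}^{n-1}d(\gamma(t_i),\gamma(t_{i+1}))$, the supremum being over all $n\ge 1$ and $t_0\le\dots\le t_n$ in $I$. $(M,d)$ is a geodesic space if for all $x,y\in M$ the distance $d(x,y)$ equals the infimum of $L(\gamma)$ over paths $\gamma$ connecting $x$ to $y$, and this infimum is attained. A geodesic is a constant speed shortest path. In particular, $\gamma:[0,1]\to M$ is a geodesic iff $d(\gamma(s),\gamma(t))=(t-s)\,d(\gamma(0),\gamma(1))$ for all $0\le s\le t\le 1$. **Curvature lower bound.** For $\kappa\in\mathbb{R}$ let $D_\kappa:=+\infty$ if $\kappa\le 0$ and $D_\kappa:=\pi/\sqrt{\kappa}$ if $\kappa>0$. For $p,x,y\in M$ let $\mathrm{peri}\{p,x,y\}:=d(p,x)+d(p,y)+d(x,y)$. If $p\notin\{x,y\}$ and $\mathrm{peri}\{p,x,y\}<2D_\kappa$,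 the comparison angle $\sphericalangle^\kappa_p(x,y)\in[0,\pi]$ is defined by \[ \cos\sphericalangle^{\kappa}_p(x,y):=\begin{cases}\dfrac{d^2(p,x)+d^2(p,y)-d^2(x,y)}{2d(p,x)d(p,y)} & \text{if }\kappa=0,\\[3mm] \dfrac{c_\kappa(d(x,y))-c_\kappa(d(p,x))\,c_\kappa(d(p,y))}{\kappa\, s_\kappa(d(p,x))\,s_\kappa(d(p,y))} & \text{if }\kappa\neq 0,\end{cases} \] where, for $r\ge 0$, $s_\kappa(r)=\sin(r\sqrt{\kappa})/\sqrt{\kappa}$ if $\kappa>0$, $s_\kappa(r)=\sinh(r\sqrt{-\kappa})/\sqrt{-\kappa}$ if $\kappa<0$, and $c_\kappa=s_\kappa'$. If $\mathrm{peri}\{p,x,y\}\ge 2D_\kappa$, the angle is undefined. $(M,d)$ has curvature lower bounded by $\kappa$ (in the sense of Alexandrov) if for all $p,x,y,z\in M$ with $p\notin\{x,y,z\}$, \[ \sphericalangle^{\kappa}_{p}(x,y)+\sphericalangle^{\kappa}_{p}(x,z)+\sphericalangle^{\kappa}_{p}(y,z)\le 2\pi \] whenever all three angles are defined. **Barycenters.** $\mathcal{P}_2(M)$ is the set of Borel probability measures $\mu$ on $M$ such that $\mathcal{V}_\mu(x):=\int_M d^2(x,y)\,\mathrm{d}\mu(y)<+\infty$ for all $x\in M$. For $\mu\in\mathcal{P}_2(M)$, $\mathcal{V}^*_\mu:=\inf_{x\in M}\mathcal{V}_\mu(x)$, and a barycenter of $\mu$ is any $x^*\in M$ with $\mathcal{V}_\mu(x^*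 )=\mathcal{V}^*_\mu$. **Geodesic convexity.** For $\alpha\in\mathbb{R}$, $f:M\to\mathbb{R}$ is geodesically $\alpha$-convex if for every geodesic $\gamma:[0,1]\to M$ the function $t\in[0,1]\mapsto f(\gamma(t))-\frac{\alpha}{2}d^2(\gamma(0),\gamma(t))$ is convex. **Local Lipschitz property.** $f:M\to\mathbb{R}$ is locally Lipschitz at $p\in M$ if there is a constant $\lambda>0$ such that $|f(x)-f(y)|\le\lambda\, d(x,y)$ for all $x,y$ in some neighborhood of $p$. *)

theory Defs
  imports "HOL-Probability.Probability"
begin

definition curve_length :: "real set \<Rightarrow> (real \<Rightarrow> 'a::metric_space) \<Rightarrow> ereal" where
  "curve_length I \<gamma> =
     (SUP (n, t) \<in> {(n, t :: nat \<Rightarrow> real). 1 \<le> n \<and> (\<forall>i\<le>n. t i \<in> I) \<and> (\<forall>i<n. t i \<le> t (Suc i))}.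
        ereal (\<Sum>i<n. dist (\<gamma> (t i)) (\<gamma> (t (Suc i)))))"

definition connecting_lengths :: "'a::metric_space \<Rightarrow> 'a \<Rightarrow> ereal set" where
  "connecting_lengths x y =
     {curve_length {a..b} \<gamma> | a b \<gamma>. a \<le> b \<and> continuous_on {a..b} \<gamma> \<and> \<gamma> a = x \<and> \<gamma> b = y}"

text \<open>The second conjunct says that the infimum is attained.\<close>
definition geodesic_space :: "'a::metric_space itself \<Rightarrow> bool" where
  "geodesic_space _ \<longleftrightarrow>
     (\<forall>x y :: 'a. Inf (connecting_lengths x y) = ereal (dist x y)
                \<and> ereal (dist x y) \<in> connecting_lengths x y)"

text \<open>Constant speed shortest paths parametrised by the unit interval; the values of
  \<open>\<gamma>\<close> outside \<open>{0..1}\<close> are irrelevant.\<close>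
definition geodesic :: "(real \<Rightarrow> 'a::metric_space) \<Rightarrow> bool" where
  "geodesic \<gamma> \<longleftrightarrow>
     (\<forall>s t. 0 \<le> s \<and> s \<le> t \<and> t \<le> 1 \<longrightarrow> dist (\<gamma> s) (\<gamma> t) = (t - s) * dist (\<gamma> 0) (\<gamma> 1))"

definition model_diameter :: "real \<Rightarrow> ereal" where
  "model_diameter \<kappa> = (if \<kappa> \<le> 0 then \<infinity> else ereal (pi / sqrt \<kappa>))"

definition sn :: "real \<Rightarrow> real \<Rightarrow> real" where
  "sn \<kappa> r = (if \<kappa> > 0 then sin (r * sqrt \<kappa>) / sqrt \<kappa>
             else if \<kappa> < 0 then sinh (r * sqrt (- \<kappa>)) / sqrt (- \<kappa>)
             else r)"

definition cn :: "real \<Rightarrow> real \<Rightarrow> real" where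
  "cn \<kappa> r = (if \<kappa> > 0 then cos (r * sqrt \<kappa>)
             else if \<kappa> < 0 then cosh (r * sqrt (- \<kappa>))
             else 1)"

lemma sn_has_real_derivative: "(sn \<kappa> has_real_derivative cn \<kappa> r) (at r)"
proof -
  have "sqrt (- \<kappa>) * (sqrt (- \<kappa>) * c) = - \<kappa> * c" if "\<kappa> < 0" for c
    using that by (simp flip: mult.assoc)
  note sq = this
  consider "\<kappa> > 0" | "\<kappa> < 0" | "\<kappa> = 0" by linarith
  then show ?thesis
    unfolding sn_def [abs_def] cn_def
    by cases (auto intro!: derivative_eq_intros simp: field_simps sq)
qed

definition perimeter :: "'a::metric_space \<Rightarrow> 'a \<Rightarrow> 'a \<Rightarrow> real" where
  "perimeter p x y = dist p x + dist p y + dist x y"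

definition comparison_angle_defined :: "real \<Rightarrow> 'a::metric_space \<Rightarrow> 'a \<Rightarrow> 'a \<Rightarrow> bool" where
  "comparison_angle_defined \<kappa> p x y \<longleftrightarrow>
     p \<notin> {x, y} \<and> ereal (perimeter p x y) < 2 * model_diameter \<kappa>"

text \<open>Only meaningful where \<open>comparison_angle_defined \<kappa> p x y\<close> holds; there the argument of
  \<open>arccos\<close> lies in \<open>{-1..1}\<close>.\<close>
definition comparison_angle :: "real \<Rightarrow> 'a::metric_space \<Rightarrow> 'a \<Rightarrow> 'a \<Rightarrow> real" where
  "comparison_angle \<kappa> p x y = arccos
     (if \<kappa> = 0
      then ((dist p x)\<^sup>2 + (dist p y)\<^sup>2 - (dist x y)\<^sup>2) / (2 * dist p x * dist p y)
      else (cn \<kappa> (dist x y) - cn \<kappa> (dist p x) * cn \<kappa> (dist p y))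
             / (\<kappa> * sn \<kappa> (dist p x) * sn \<kappa> (dist p y)))"

definition curvature_bounded_below :: "'a::metric_space itself \<Rightarrow> real \<Rightarrow> bool" where
  "curvature_bounded_below _ \<kappa> \<longleftrightarrow>
     (\<forall>p x y z :: 'a. p \<notin> {x, y, z}
        \<and> comparison_angle_defined \<kappa> p x y
        \<and> comparison_angle_defined \<kappa> p x z
        \<and> comparison_angle_defined \<kappa> p y z
      \<longrightarrow> comparison_angle \<kappa> p x y + comparison_angle \<kappa> p x z + comparison_angle \<kappa> p y z \<le> 2 * pi)"

definition frechet_var :: "'a::metric_space measure \<Rightarrow> 'a \<Rightarrow> ennreal" where
  "frechet_var \<mu> x = (\<integral>\<^sup>+ y. ennreal ((dist x y)\<^sup>2) \<partial>\<mu>)"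

definition P2 :: "'a::metric_space measure set" where
  "P2 = {\<mu>. sets \<mu> = sets borel \<and> prob_space \<mu> \<and> (\<forall>x. frechet_var \<mu> x < \<infinity>)}"

definition min_frechet_var :: "'a::metric_space measure \<Rightarrow> ennreal" where
  "min_frechet_var \<mu> = (INF x. frechet_var \<mu> x)"

definition barycenter :: "'a::metric_space measure \<Rightarrow> 'a \<Rightarrow> bool" where
  "barycenter \<mu> x \<longleftrightarrow> frechet_var \<mu> x = min_frechet_var \<mu>"

definition geodesically_convex :: "real \<Rightarrow> ('a::metric_space \<Rightarrow> real) \<Rightarrow> bool" where
  "geodesically_convex \<alpha> f \<longleftrightarrow>
     (\<forall>\<gamma>. geodesic \<gamma> \<longrightarrow> convex_on {0..1} (\<lambda>t. f (\<gamma> t) - \<alpha> / 2 * (dist (\<gamma> 0) (\<gamma> t))\<^sup>2))"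

definition locally_lipschitz_at :: "('a::metric_space \<Rightarrow> real) \<Rightarrow> 'a \<Rightarrow> bool" where
  "locally_lipschitz_at f p \<longleftrightarrow> (\<exists>L>0. \<exists>U. open U \<and> p \<in> U \<and> L-lipschitz_on U f)"

end

theory Submission
  imports Defs
begin

text \<open>
  Write \<open>p\<close> for the barycenter, \<open>R = d(p,x)\<close>, and let \<open>s\<close> be the supremum over \<open>y \<noteq> p\<close> of
  \<open>(f p - f y) / d(p,y) + \<alpha> d(p,y) / 2\<close>; it is finite because \<open>f\<close> is Lipschitz near \<open>p\<close>, and
  convexity allows one to approach it by points \<open>q\<close> arbitrarily close to \<open>p\<close>. From a point \<open>a\<close> on
  the geodesic \<open>[p,q]\<close>, very close to \<open>p\<close>, move a much shorter distance towards \<open>x\<close>, to \<open>z\<close>. As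
  \<open>a\<close> is interior to \<open>[p,q]\<close>, the curvature bound controls \<open>d(p,z)\<close> from above, in terms of
  \<open>d(q,x)\<close>. Since \<open>f z\<close> is at least \<open>f p - s d(p,z)\<close> up to second order and at most the convex
  interpolation of \<open>f a\<close> and \<open>f x\<close>, this yields, up to an error of order \<open>\<theta> (1 + R\<^sup>2)\<close> with \<open>\<theta>\<close>
  as small as desired,
  \<open>f x \<ge> f p + \<alpha> R\<^sup>2 / 2 - c (R\<^sup>2 - d(q,x)\<^sup>2)\<close> where \<open>c = s / (2 d(p,q)) \<ge> 0\<close>.
  Upon integration the last term is nonnegative because \<open>p\<close> is a barycenter. Thus
  only the distance functions to \<open>p\<close> and \<open>q\<close> are ever integrated, and neither tangent cones nor
  gradients are needed.
\<close>

section \<open>Trigonometric comparison\<close>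

text \<open>Concavity of the sine on \<open>{0..pi}\<close>: its graph lies above the chord from 0
  to y. Thus sin t / t is nonincreasing; the denominators are cleared so that x = 0 is
  allowed.\<close>

lemma sin_div_antimono:
  fixes x y :: real
  assumes "0 \<le> x" "x \<le> y" "0 < y" "y \<le> pi"
  shows "x * sin y \<le> y * sin x"
proof -
  have cv: "convex_on {0..pi} (\<lambda>x::real. - sin x)"
    by (rule convex_on_realI[where f' = "\<lambda>x. - cos x"])
       (auto intro!: derivative_eq_intros cos_monotone_0_pi_le)
  have "- sin ((1 - x/y) *\<^sub>R 0 + (x/y) *\<^sub>R y) \<le> (1 - x/y) * (- sin 0) + (x/y) * (- sin y)"
    using assms by (intro convex_onD[OF cv]) auto
  then show ?thesis using assms by (simp add: field_simps)
qed

lemma sinh_div_mono: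
  fixes x y :: real
  assumes "0 \<le> x" "x \<le> y" "0 < y"
  shows "y * sinh x \<le> x * sinh y"
proof -
  have cv: "convex_on {0..} (\<lambda>x::real. sinh x)"
    by (rule convex_on_realI[where f' = cosh])
       (auto intro!: derivative_eq_intros simp: cosh_real_nonneg_le_iff)
  have "sinh ((1 - x/y) *\<^sub>R 0 + (x/y) *\<^sub>R y) \<le> (1 - x/y) * sinh 0 + (x/y) * sinh y"
    using assms by (intro convex_onD[OF cv]) auto
  then show ?thesis using assms by (simp add: field_simps)
qed

text \<open>As a function of x^2, the cosine has derivative - sin x / (2 x), which is nondecreasing
  by \<open>sin_div_antimono\<close>. So it is convex in x^2, and the left side is its tangent at x
  = e.\<close>

lemma cos_ge_quadratic:
  fixes x e :: real
  assumes x: "0 \<le> x" "x \<le> pi" and e: "0 < e" "e \<le> pi"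
  shows "cos e + sin e / (2 * e) * (e\<^sup>2 - x\<^sup>2) \<le> cos x"
proof -
  define g where "g = (\<lambda>t. cos t + sin e / (2 * e) * t\<^sup>2)"
  have der: "(g has_real_derivative (t * sin e - e * sin t) / e) (at t)" for t
    unfolding g_def using e by (auto intro!: derivative_eq_intros simp: field_simps)
  have "g e \<le> g x"
  proof (cases "e \<le> x")
    case True
    show ?thesis
    proof (rule DERIV_nonneg_imp_nondecreasing[OF True])
      fix t assume t: "e \<le> t" "t \<le> x"
      have "e * sin t \<le> t * sin e" using sin_div_antimono[of e t] t x e by auto
      then show "\<exists>y. (g has_real_derivative y) (at t) \<and> 0 \<le> y"
        using der[of t] e by (intro exI[of _ "(t * sin e - e * sin t) / e"]) auto
    qed
  next
    case False
    then have "x \<le> e" by simp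
    then show ?thesis
    proof (rule DERIV_nonpos_imp_nonincreasing)
      fix t assume t: "x \<le> t" "t \<le> e"
      have "t * sin e \<le> e * sin t" using sin_div_antimono[of t e] t x e by auto
      then show "\<exists>y. (g has_real_derivative y) (at t) \<and> y \<le> 0"
        using der[of t] e by (intro exI[of _ "(t * sin e - e * sin t) / e"]) (auto simp: divide_le_0_iff)
    qed
  qed
  then show ?thesis by (simp add: g_def algebra_simps)
qed

text \<open>The same tangent argument: cosh is convex as a function of x^2, with derivative sinh x /
  (2 x).\<close>

lemma cosh_ge_quadratic:
  fixes x e :: real
  assumes x: "0 \<le> x" "x \<le> e" and e: "0 < e"
  shows "cosh e - sinh e / (2 * e) * (e\<^sup>2 - x\<^sup>2) \<le> cosh x"
proof -
  define g where "g = (\<lambda>t. cosh t - sinh e / (2 * e) * t\<^sup>2)"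
  have der: "(g has_real_derivative (e * sinh t - t * sinh e) / e) (at t)" for t
    unfolding g_def using e by (auto intro!: derivative_eq_intros simp: field_simps)
  have "g e \<le> g x"
  proof (rule DERIV_nonpos_imp_nonincreasing[OF x(2)])
    fix t assume t: "x \<le> t" "t \<le> e"
    have "e * sinh t \<le> t * sinh e" using sinh_div_mono[of t e] t x e by auto
    then show "\<exists>y. (g has_real_derivative y) (at t) \<and> y \<le> 0"
      using der[of t] e by (intro exI[of _ "(e * sinh t - t * sinh e) / e"]) (auto simp: divide_le_0_iff)
  qed
  then show ?thesis by (simp add: g_def algebra_simps)
qed

text \<open>This is x coth x \<le> 1 + x^2. The quadratic excess is the source of the error term in
  the hyperbolic comparison.\<close>

lemma mult_cosh_le:
  fixes x :: real
  assumes "0 \<le> x"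
  shows "x * cosh x \<le> (1 + x\<^sup>2) * sinh x"
proof -
  define g where "g = (\<lambda>t::real. (1 + t\<^sup>2) * sinh t - t * cosh t)"
  have der: "(g has_real_derivative (t * sinh t + t\<^sup>2 * cosh t)) (at t)" for t
    unfolding g_def by (auto intro!: derivative_eq_intros simp: algebra_simps)
  have "g 0 \<le> g x"
    by (rule DERIV_nonneg_imp_nondecreasing[OF assms]) (use der in \<open>fastforce\<close>)
  then show ?thesis by (simp add: g_def)
qed

section \<open>The law of cosines in the model planes and its Euclidean bound\<close>

text \<open>The cosine of the angle between sides b and c, opposite to side e, in the model plane of
  curvature \<kappa>. Taking side lengths instead of points leaves inequalities between real
  numbers.\<close>

definition model_cos :: "real \<Rightarrow> real \<Rightarrow> real \<Rightarrow> real \<Rightarrow> real" where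
  "model_cos \<kappa> b c e =
     (if \<kappa> = 0 then (b\<^sup>2 + c\<^sup>2 - e\<^sup>2) / (2 * b * c)
      else (cn \<kappa> e - cn \<kappa> b * cn \<kappa> c) / (\<kappa> * sn \<kappa> b * sn \<kappa> c))"

lemma comparison_angle_eq:
  "comparison_angle \<kappa> p x y = arccos (model_cos \<kappa> (dist p x) (dist p y) (dist x y))"
  by (simp add: comparison_angle_def model_cos_def)

lemma model_cos_pos:
  assumes "\<kappa> > 0"
  shows "model_cos \<kappa> b c e =
    (cos (e * sqrt \<kappa>) - cos (b * sqrt \<kappa>) * cos (c * sqrt \<kappa>)) / (sin (b * sqrt \<kappa>) * sin (c * sqrt \<kappa>))"
proof -
  have "\<kappa> * (x / sqrt \<kappa>) * (y / sqrt \<kappa>) = x * y" for x y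
    using assms real_sqrt_mult_self[of \<kappa>] by (simp add: field_simps)
  then show ?thesis using assms by (simp add: model_cos_def cn_def sn_def)
qed

lemma model_cos_neg:
  assumes "\<kappa> < 0"
  shows "model_cos \<kappa> b c e =
    (cosh (b * sqrt (-\<kappa>)) * cosh (c * sqrt (-\<kappa>)) - cosh (e * sqrt (-\<kappa>)))
      / (sinh (b * sqrt (-\<kappa>)) * sinh (c * sqrt (-\<kappa>)))"
proof -
  have *: "\<kappa> * (x / sqrt (-\<kappa>)) * (y / sqrt (-\<kappa>)) = - (x * y)" for x y
    using assms real_sqrt_mult_self[of "-\<kappa>"] by (simp add: field_simps)
  have "(u - v) / - w = (v - u) / w" for u v w :: real
    by (simp add: minus_divide_left flip: minus_divide_right)
  then show ?thesis using assms by (simp add: model_cos_def cn_def sn_def *)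
qed

lemma triangle_scale:
  fixes b c e k :: real
  assumes k: "0 < k" and "e \<le> b + c" "\<bar>b - c\<bar> \<le> e"
  shows "e * k \<le> b * k + c * k" "\<bar>b * k - c * k\<bar> \<le> e * k"
proof -
  show "e * k \<le> b * k + c * k"
    using mult_right_mono[OF assms(2), of k] k by (simp add: distrib_right)
  have "\<bar>b * k - c * k\<bar> = \<bar>b - c\<bar> * k"
    using k by (simp add: abs_mult flip: left_diff_distrib)
  then show "\<bar>b * k - c * k\<bar> \<le> e * k"
    using mult_right_mono[OF assms(3), of k] k by simp
qed

text \<open>A degenerate triangle has angle pi, by the addition theorems. This gives the angle
  between the two halves of a geodesic at an interior point.\<close>

lemma model_cos_add:
  assumes "0 < b" "0 < c" "\<kappa> > 0 \<longrightarrow> (b + c) * sqrt \<kappa> < pi"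
  shows "model_cos \<kappa> b c (b + c) = -1"
proof -
  consider "\<kappa> > 0" | "\<kappa> < 0" | "\<kappa> = 0" by linarith
  then show ?thesis
  proof cases
    case 1
    let ?k = "sqrt \<kappa>"
    have k: "?k > 0" using 1 by simp
    have "0 < b * ?k" "0 < c * ?k" "b * ?k + c * ?k < pi"
      using assms 1 k by (auto simp: algebra_simps)
    then have "sin (b * ?k) > 0" "sin (c * ?k) > 0"
      by (auto intro!: sin_gt_zero)
    then show ?thesis using 1
      by (simp add: model_cos_pos distrib_right cos_add)
  next
    case 2
    let ?k = "sqrt (-\<kappa>)"
    have "0 < sinh (b * ?k) * sinh (c * ?k)" using assms 2 by auto
    moreover have "model_cos \<kappa> b c (b + c) = - (sinh (b * ?k) * sinh (c * ?k)) / (sinh (b * ?k) * sinh (c * ?k))"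
      using 2 by (simp add: model_cos_neg distrib_right cosh_add)
    ultimately show ?thesis by (metis div_minus1_right divide_self_if less_irrefl minus_divide_left)
  next
    case 3
    then show ?thesis using assms
      by (simp add: model_cos_def power2_eq_square field_simps)
  qed
qed

text \<open>The cosine of the angle is monotone in e, and the extremes e = b + c and e = |b - c|
  give -1 and 1. The bounds are what makes \<open>arccos\<close> invertible on these values.\<close>

lemma model_cos_bounds:
  assumes "0 < b" "0 < c" "e \<le> b + c" "\<bar>b - c\<bar> \<le> e" "\<kappa> > 0 \<longrightarrow> (b + c) * sqrt \<kappa> < pi"
  shows "-1 \<le> model_cos \<kappa> b c e" "model_cos \<kappa> b c e \<le> 1"
proof -
  consider "\<kappa> > 0" | "\<kappa> < 0" | "\<kappa> = 0" by linarith
  then have "-1 \<le> model_cos \<kappa> b c e \<and> model_cos \<kappa> b c e \<le> 1"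
  proof cases
    case 1
    define k where "k = sqrt \<kappa>"
    have k: "k > 0" using 1 k_def by simp
    have bc: "0 < b * k" "0 < c * k" "b * k + c * k < pi"
      using assms 1 k by (auto simp: algebra_simps k_def)
    then have s: "sin (b * k) > 0" "sin (c * k) > 0"
      by (auto intro!: sin_gt_zero)
    have e: "0 \<le> e * k" "e * k \<le> b * k + c * k" "\<bar>b * k - c * k\<bar> \<le> e * k"
      using triangle_scale[OF k assms(3,4)] assms(4) k by auto
    have "cos (b * k + c * k) \<le> cos (e * k)"
      using e bc by (intro cos_monotone_0_pi_le) auto
    moreover have "cos (e * k) \<le> cos \<bar>b * k - c * k\<bar>"
      using e bc by (intro cos_monotone_0_pi_le) auto
    ultimately show ?thesis using s 1
      by (simp add: model_cos_pos cos_add cos_diff flip: k_def) (simp add: field_simps)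
  next
    case 2
    define k where "k = sqrt (-\<kappa>)"
    have k: "k > 0" using 2 k_def by simp
    have bc: "0 < b * k" "0 < c * k"
      using assms 2 k by (auto simp: algebra_simps k_def)
    then have s: "sinh (b * k) > 0" "sinh (c * k) > 0" by auto
    have e: "0 \<le> e * k" "e * k \<le> b * k + c * k" "\<bar>b * k - c * k\<bar> \<le> e * k"
      using triangle_scale[OF k assms(3,4)] assms(4) k by auto
    have "cosh (e * k) \<le> cosh (b * k + c * k)"
      using e bc by (subst cosh_real_nonneg_le_iff) auto
    moreover have "cosh \<bar>b * k - c * k\<bar> \<le> cosh (e * k)"
      using e bc by (subst cosh_real_nonneg_le_iff) auto
    ultimately show ?thesis using s 2
      by (simp add: model_cos_neg cosh_add cosh_diff flip: k_def) (simp add: field_simps)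
  next
    case 3
    have "(b - c)\<^sup>2 \<le> e\<^sup>2" using assms(4) by (metis abs_ge_zero power2_abs power_mono)
    moreover have "e\<^sup>2 \<le> (b + c)\<^sup>2" using assms by (intro power_mono) auto
    ultimately show ?thesis using 3 assms
      by (simp add: model_cos_def power2_eq_square field_simps)
  qed
  then show "-1 \<le> model_cos \<kappa> b c e" "model_cos \<kappa> b c e \<le> 1" by auto
qed

text \<open>As functions of \<open>e\<^sup>2\<close>, the left side below is convex, the right side is linear, and they agree at
  both extremes \<open>e = \<bar>b - c\<bar>\<close> and \<open>e = b + c\<close>.\<close>
lemma spherical_cos_le_euclidean:
  fixes b c e :: real
  assumes "0 < b" "0 < c" "b + c < pi" "e \<le> b + c" "\<bar>b - c\<bar> \<le> e"
  shows "(cos e - cos b * cos c) / (sin b * sin c) \<le> (b\<^sup>2 + c\<^sup>2 - e\<^sup>2) / (2 * b * c)"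
proof (cases "e = 0")
  case True
  then have "b = c" using assms by auto
  moreover have "sin c > 0" using assms by (intro sin_gt_zero) auto
  moreover have "1 - cos c * cos c = sin c * sin c"
    using sin_cos_squared_add[of c] by (simp add: power2_eq_square)
  ultimately show ?thesis using True assms by (simp add: power2_eq_square)
next
  case False
  then have e: "0 < e" "e \<le> pi" using assms by auto
  have s: "sin b > 0" "sin c > 0" using assms by (auto intro!: sin_gt_zero)
  define \<sigma> where "\<sigma> = sin e / (2 * e)"
  have 1: "cos e + \<sigma> * (e\<^sup>2 - (b - c)\<^sup>2) \<le> cos b * cos c + sin b * sin c"
    using cos_ge_quadratic[of "\<bar>b - c\<bar>" e] assms e by (simp add: \<sigma>_def cos_diff)
  have 2: "cos e + \<sigma> * (e\<^sup>2 - (b + c)\<^sup>2) \<le> cos b * cos c - sin b * sin c"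
    using cos_ge_quadratic[of "b + c" e] assms e by (simp add: \<sigma>_def cos_add)
  have "(b - c)\<^sup>2 \<le> e\<^sup>2" using assms(5) by (metis abs_ge_zero power2_abs power_mono)
  moreover have "e\<^sup>2 \<le> (b + c)\<^sup>2" using assms by (intro power_mono) auto
  \<comment> \<open>These weights write e^2 as a convex combination of (b - c)^2 and (b + c)^2, up
    to the factor 4 b c. The terms with \<sigma> cancel.\<close>
  ultimately have "((b + c)\<^sup>2 - e\<^sup>2) * (cos e + \<sigma> * (e\<^sup>2 - (b - c)\<^sup>2))
      + (e\<^sup>2 - (b - c)\<^sup>2) * (cos e + \<sigma> * (e\<^sup>2 - (b + c)\<^sup>2))
     \<le> ((b + c)\<^sup>2 - e\<^sup>2) * (cos b * cos c + sin b * sin c)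
      + (e\<^sup>2 - (b - c)\<^sup>2) * (cos b * cos c - sin b * sin c)"
    by (intro add_mono mult_left_mono 1 2) auto
  then have "2 * (2 * b * c * (cos e - cos b * cos c)) \<le> 2 * ((b\<^sup>2 + c\<^sup>2 - e\<^sup>2) * (sin b * sin c))"
    by (simp add: power2_eq_square algebra_simps)
  then show ?thesis using s assms by (simp add: field_simps)
qed

text \<open>Here the left side is concave in \<open>e\<^sup>2\<close>; it is bounded by its tangent at \<open>e = b + c\<close>.\<close>
lemma hyperbolic_cos_le_euclidean:
  fixes b c e :: real
  assumes "0 < b" "0 < c" "e \<le> b + c" "\<bar>b - c\<bar> \<le> e"
  shows "(cosh b * cosh c - cosh e) / (sinh b * sinh c) \<le> (b\<^sup>2 + c\<^sup>2 - e\<^sup>2) / (2 * b * c) + 2 * b * c"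
proof -
  define S where "S = sinh b * sinh c"
  define M where "M = b + c"
  define Y where "Y = (M\<^sup>2 - e\<^sup>2) / 2"
  define T where "T = sinh M / M"
  have S: "S > 0" and M: "M > 0" using assms by (auto simp: S_def M_def)
  have "(b - c)\<^sup>2 \<le> e\<^sup>2" using assms(4) by (metis abs_ge_zero power2_abs power_mono)
  then have Y2: "Y \<le> 2 * b * c" by (simp add: Y_def M_def power2_eq_square algebra_simps)
  have "e\<^sup>2 \<le> M\<^sup>2" using assms unfolding M_def by (intro power_mono) auto
  then have Y0: "0 \<le> Y" by (simp add: Y_def)
  have "cosh M - T * Y \<le> cosh e"
    using cosh_ge_quadratic[of e M] assms M by (simp add: T_def Y_def M_def mult.commute)
  then have 1: "cosh b * cosh c - cosh e \<le> T * Y - S"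
    by (simp add: M_def S_def cosh_add)
  \<comment> \<open>\<open>mult_cosh_le\<close> is used for c and for b. The left side is b c sinh
    (b + c), the right side is S (1 + b c) (b + c), so this bounds the tangent slope
    \<open>T\<close>.\<close>
  have "b * sinh b * (c * cosh c) + c * sinh c * (b * cosh b)
     \<le> b * sinh b * ((1 + c\<^sup>2) * sinh c) + c * sinh c * ((1 + b\<^sup>2) * sinh b)"
    using assms by (intro add_mono mult_left_mono mult_cosh_le) auto
  then have "sinh M * (b * c) \<le> S * (1 + b * c) * M"
    by (simp add: M_def S_def sinh_add power2_eq_square algebra_simps)
  then have "T * (b * c) \<le> S * (1 + b * c)"
    using M by (simp add: T_def field_simps)
  then have "T \<le> S * (1 + b * c) / (b * c)" using assms by (simp add: field_simps)
  then have "T * Y \<le> S * (1 + b * c) / (b * c) * Y" by (rule mult_right_mono[OF _ Y0])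
  then have "(cosh b * cosh c - cosh e) / S \<le> (S * (1 + b * c) / (b * c) * Y - S) / S"
    using 1 S by (intro divide_right_mono) auto
  also have "\<dots> = (1 + b * c) / (b * c) * Y - 1"
    using S assms by (simp add: field_simps)
  also have "\<dots> = Y / (b * c) - 1 + Y" using assms by (simp add: field_simps)
  also have "Y / (b * c) - 1 = (b\<^sup>2 + c\<^sup>2 - e\<^sup>2) / (2 * b * c)"
    using assms by (simp add: Y_def M_def field_simps power2_eq_square)
  finally show ?thesis using Y2 by (simp add: S_def)
qed

text \<open>Rescaling by the square root of |\<kappa>| reduces to curvature 1 or -1. The Euclidean
  fraction is invariant under scaling, while the hyperbolic excess 2 b c acquires the factor
  |\<kappa>|.\<close>

lemma model_cos_le_euclidean:
  assumes "0 < b" "0 < c" "e \<le> b + c" "\<bar>b - c\<bar> \<le> e" "\<kappa> > 0 \<longrightarrow> (b + c) * sqrt \<kappa> < pi"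
  shows "model_cos \<kappa> b c e \<le> (b\<^sup>2 + c\<^sup>2 - e\<^sup>2) / (2 * b * c) + 2 * \<bar>\<kappa>\<bar> * b * c"
proof -
  consider "\<kappa> > 0" | "\<kappa> < 0" | "\<kappa> = 0" by linarith
  then show ?thesis
  proof cases
    case 1
    define k where "k = sqrt \<kappa>"
    have k: "k > 0" using 1 k_def by simp
    have "model_cos \<kappa> b c e \<le> ((b*k)\<^sup>2 + (c*k)\<^sup>2 - (e*k)\<^sup>2) / (2 * (b*k) * (c*k))"
      unfolding model_cos_pos[OF 1] k_def[symmetric]
      using assms 1 k triangle_scale[OF k assms(3,4)]
      by (intro spherical_cos_le_euclidean) (auto simp: distrib_right k_def)
    also have "\<dots> = (k\<^sup>2 * (b\<^sup>2 + c\<^sup>2 - e\<^sup>2)) / (k\<^sup>2 * (2 * b * c))"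
      by (simp add: power_mult_distrib algebra_simps power2_eq_square)
    also have "\<dots> = (b\<^sup>2 + c\<^sup>2 - e\<^sup>2) / (2 * b * c)" using k by simp
    finally have "model_cos \<kappa> b c e \<le> (b\<^sup>2 + c\<^sup>2 - e\<^sup>2) / (2 * b * c)" .
    moreover have "0 \<le> 2 * \<bar>\<kappa>\<bar> * b * c" using assms by simp
    ultimately show ?thesis by linarith
  next
    case 2
    define k where "k = sqrt (-\<kappa>)"
    have k: "k > 0" "k\<^sup>2 = \<bar>\<kappa>\<bar>" using 2 k_def by simp_all
    have "model_cos \<kappa> b c e \<le> ((b*k)\<^sup>2 + (c*k)\<^sup>2 - (e*k)\<^sup>2) / (2 * (b*k) * (c*k)) + 2 * (b*k) * (c*k)"
      unfolding model_cos_neg[OF 2] k_def[symmetric]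
      using assms 2 k triangle_scale[OF k(1) assms(3,4)]
      by (intro hyperbolic_cos_le_euclidean) (auto simp: k_def)
    also have "((b*k)\<^sup>2 + (c*k)\<^sup>2 - (e*k)\<^sup>2) / (2 * (b*k) * (c*k)) =
       (k\<^sup>2 * (b\<^sup>2 + c\<^sup>2 - e\<^sup>2)) / (k\<^sup>2 * (2 * b * c))"
      by (simp add: power_mult_distrib algebra_simps power2_eq_square)
    also have "\<dots> = (b\<^sup>2 + c\<^sup>2 - e\<^sup>2) / (2 * b * c)" using k 2 by simp
    also have "2 * (b*k) * (c*k) = 2 * \<bar>\<kappa>\<bar> * b * c" unfolding k(2)[symmetric]
      by (simp add: power2_eq_square algebra_simps)
    finally show ?thesis .
  next
    case 3
    then show ?thesis by (simp add: model_cos_def)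
  qed
qed

section \<open>Semiconcavity of the squared distance\<close>

text \<open>Since a lies between y and z, the angle at a towards them is pi, so the curvature bound
  leaves at most pi for the other two angles; as the cosine decreases, their cosines have
  nonnegative sum. The perimeters are at most 3 \<rho>, which keeps all three angles
  defined.\<close>

lemma model_angles_le_pi:
  fixes a y z w :: "'a::metric_space"
  assumes curv: "curvature_bounded_below TYPE('a) \<kappa>"
    and ne: "a \<noteq> y" "a \<noteq> z" "a \<noteq> w"
    and btw: "dist a y + dist a z = dist y z"
    and small: "dist y z \<le> \<rho>" "dist y w \<le> \<rho>" "dist z w \<le> \<rho>" "dist a w \<le> \<rho>"
    and \<rho>: "\<kappa> > 0 \<longrightarrow> \<rho> * sqrt \<kappa> \<le> 1"
  shows "0 \<le> model_cos \<kappa> (dist a y) (dist a w) (dist y w) + model_cos \<kappa> (dist a z) (dist a w) (dist z w)"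
proof -
  let ?X = "model_cos \<kappa> (dist a y) (dist a w) (dist y w)"
  let ?Y = "model_cos \<kappa> (dist a z) (dist a w) (dist z w)"
  have pi3: "3 < pi" using pi_gt3 .
  have ay: "dist a y \<le> \<rho>" and az: "dist a z \<le> \<rho>"
    using btw small(1) zero_le_dist[of a y] zero_le_dist[of a z] by linarith+
  have pos: "0 < dist a y" "0 < dist a z" "0 < dist a w" using ne by auto
  have r: "t * sqrt \<kappa> < pi" if "\<kappa> > 0" "t \<le> 2 * \<rho>" for t
  proof -
    have "t * sqrt \<kappa> \<le> (2 * \<rho>) * sqrt \<kappa>" using that by (intro mult_right_mono) auto
    also have "\<dots> \<le> 2" using \<rho> that by auto
    finally show ?thesis using pi3 by linarith
  qed
  have def: "comparison_angle_defined \<kappa> a u v"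
    if "a \<noteq> u" "a \<noteq> v" "dist a u \<le> \<rho>" "dist a v \<le> \<rho>" "dist u v \<le> \<rho>" for u v
  proof (cases "\<kappa> > 0")
    case True
    have "perimeter a u v \<le> 3 * \<rho>" using that by (simp add: perimeter_def)
    then have "perimeter a u v * sqrt \<kappa> \<le> (3 * \<rho>) * sqrt \<kappa>"
      using True by (intro mult_right_mono) auto
    also have "\<dots> \<le> 3" using \<rho> True by auto
    finally have "perimeter a u v < 2 * (pi / sqrt \<kappa>)"
      using pi3 True by (simp add: field_simps)
    then have "ereal (perimeter a u v) < ereal 2 * ereal (pi / sqrt \<kappa>)"
      by (simp only: times_ereal.simps less_ereal.simps)
    then show ?thesis using that True
      by (simp add: comparison_angle_defined_def model_diameter_def)
  next
    case False
    then show ?thesis using that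
      by (simp add: comparison_angle_defined_def model_diameter_def)
  qed
  have X: "-1 \<le> ?X" "?X \<le> 1"
    using model_cos_bounds[of "dist a y" "dist a w" "dist y w" \<kappa>] pos ay small r
      dist_triangle3[of y w a] dist_triangle[of a y w] dist_triangle[of a w y]
    by (auto simp: dist_commute abs_le_iff)
  have Y: "-1 \<le> ?Y" "?Y \<le> 1"
    using model_cos_bounds[of "dist a z" "dist a w" "dist z w" \<kappa>] pos az small r
      dist_triangle3[of z w a] dist_triangle[of a z w] dist_triangle[of a w z]
    by (auto simp: dist_commute abs_le_iff)
  have "model_cos \<kappa> (dist a y) (dist a z) (dist y z) = -1"
    using model_cos_add[of "dist a y" "dist a z" \<kappa>] pos btw small r by auto
  then have "comparison_angle \<kappa> a y z = pi" by (simp add: comparison_angle_eq)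
  moreover have "comparison_angle \<kappa> a y z + comparison_angle \<kappa> a y w + comparison_angle \<kappa> a z w \<le> 2 * pi"
    using curv def ne ay az small unfolding curvature_bounded_below_def by auto
  ultimately have "arccos ?X + arccos ?Y \<le> pi" by (simp add: comparison_angle_eq)
  then have "arccos ?X \<le> arccos (- ?Y)" using Y by (simp add: arccos_minus)
  then have "- ?Y \<le> ?X" using X Y by (subst (asm) arccos_le_mono) auto
  then show ?thesis by simp
qed

text \<open>For \<open>\<kappa> \<ge> 0\<close> the factor 1 would do; for \<open>\<kappa> < 0\<close> the excess is quadratic in \<open>d(a,w)\<close>, which
  keeps it negligible below, where \<open>a\<close> and \<open>w\<close> are close.\<close>
lemma sq_dist_semiconcave:
  fixes a y z w :: "'a::metric_space"
  assumes curv: "curvature_bounded_below TYPE('a) \<kappa>"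
    and t: "0 \<le> t" "t \<le> 1" "dist y a = t * dist y z" "dist a z = (1 - t) * dist y z"
    and small: "dist y z \<le> \<rho>" "dist y w \<le> \<rho>" "dist z w \<le> \<rho>" "dist a w \<le> \<rho>"
    and \<rho>: "\<kappa> > 0 \<longrightarrow> \<rho> * sqrt \<kappa> \<le> 1"
  shows "(1 - t) * (dist y w)\<^sup>2 + t * (dist z w)\<^sup>2
      - (1 + 4 * \<bar>\<kappa>\<bar> * (dist a w)\<^sup>2) * (t * (1 - t) * (dist y z)\<^sup>2) \<le> (dist a w)\<^sup>2"
proof -
  define l where "l = dist y z"
  define c where "c = dist a w"
  have l0: "l \<ge> 0" by (simp add: l_def)
  \<comment> \<open>Angles at a require a to differ from y, z and w; in the degenerate positions the
    inequality is checked directly.\<close>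
  consider "a = y" | "a = z" | "a = w" | "a \<noteq> y" "a \<noteq> z" "a \<noteq> w" by blast
  then show ?thesis
  proof cases
    case 1
    then have "t * l = 0" using t by (simp add: l_def)
    then have "t = 0 \<or> l = 0" by simp
    then show ?thesis
    proof
      assume "l = 0" then have "z = y" by (simp add: l_def)
      then show ?thesis using 1 by (simp add: algebra_simps)
    qed (use 1 in simp)
  next
    case 2
    then have "(1 - t) * l = 0" using t by (simp add: l_def)
    then have "t = 1 \<or> l = 0" by simp
    then show ?thesis
    proof
      assume "l = 0" then have "z = y" by (simp add: l_def)
      then show ?thesis using 2 by (simp add: algebra_simps)
    qed (use 2 in simp)
  next
    case 3
    have d: "dist y w = t * l" "dist z w = (1 - t) * l" "dist a w = 0"
      using t 3 by (auto simp: dist_commute l_def)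
    show ?thesis unfolding d l_def[symmetric] by (simp add: power2_eq_square algebra_simps)
  next
    case 4
    have ay: "dist a y = t * l" and az: "dist a z = (1 - t) * l"
      using t by (auto simp: dist_commute l_def)
    have l: "0 < l" and t01: "0 < t" "t < 1" and c: "0 < c"
      using ay az l0 t 4 by (auto simp: c_def less_le)
    have b: "0 < t * l" "0 < (1 - t) * l" using l t01 by auto
    have btw: "dist a y + dist a z = dist y z" by (simp add: ay az l_def algebra_simps)
    have ayr: "dist a y \<le> \<rho>" and azr: "dist a z \<le> \<rho>"
      using btw small(1) zero_le_dist[of a y] zero_le_dist[of a z] by linarith+
    have r: "s * sqrt \<kappa> < pi" if "\<kappa> > 0" "s \<le> 2 * \<rho>" for s
    proof -
      have "s * sqrt \<kappa> \<le> (2 * \<rho>) * sqrt \<kappa>" using that by (intro mult_right_mono) auto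
      also have "\<dots> \<le> 2" using \<rho> that by auto
      finally show ?thesis using pi_gt3 by linarith
    qed
    have X: "model_cos \<kappa> (dist a y) (dist a w) (dist y w)
        \<le> ((t*l)\<^sup>2 + c\<^sup>2 - (dist y w)\<^sup>2) / (2 * (t*l) * c) + 2 * \<bar>\<kappa>\<bar> * (t*l) * c"
      using model_cos_le_euclidean[of "dist a y" "dist a w" "dist y w" \<kappa>] b c ayr small r
        dist_triangle3[of y w a] dist_triangle[of a y w] dist_triangle[of a w y]
      by (auto simp: dist_commute abs_le_iff ay c_def)
    have Y: "model_cos \<kappa> (dist a z) (dist a w) (dist z w)
        \<le> (((1-t)*l)\<^sup>2 + c\<^sup>2 - (dist z w)\<^sup>2) / (2 * ((1-t)*l) * c) + 2 * \<bar>\<kappa>\<bar> * ((1-t)*l) * c"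
      using model_cos_le_euclidean[of "dist a z" "dist a w" "dist z w" \<kappa>] b c azr small r
        dist_triangle3[of z w a] dist_triangle[of a z w] dist_triangle[of a w z]
      by (auto simp: dist_commute abs_le_iff az c_def)
    have "0 \<le> (((t*l)\<^sup>2 + c\<^sup>2 - (dist y w)\<^sup>2) / (2 * (t*l) * c) + 2 * \<bar>\<kappa>\<bar> * (t*l) * c)
      + ((((1-t)*l)\<^sup>2 + c\<^sup>2 - (dist z w)\<^sup>2) / (2 * ((1-t)*l) * c) + 2 * \<bar>\<kappa>\<bar> * ((1-t)*l) * c)"
      using model_angles_le_pi[OF curv 4 btw small \<rho>] X Y by linarith
    \<comment> \<open>This factor clears both denominators and leaves the interpolation weights 1 -
      t and t.\<close>
    then have "0 \<le> (2 * t * (1 - t) * l * c) * (\<dots>)"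
      using t01 l c by (intro mult_nonneg_nonneg) auto
    also have "\<dots> = (1 - t) * ((t*l)\<^sup>2 + c\<^sup>2 - (dist y w)\<^sup>2) + t * (((1-t)*l)\<^sup>2 + c\<^sup>2 - (dist z w)\<^sup>2)
        + 4 * \<bar>\<kappa>\<bar> * c\<^sup>2 * (t * (1 - t) * l\<^sup>2)"
    proof -
      have 1: "(2 * t * (1 - t) * l * c) * (A / (2 * (t*l) * c)) = (1 - t) * A" for A
        using t01 l c by (simp add: field_simps)
      have "1 - t \<noteq> 0" using t01 by simp
      then have 2: "(2 * t * (1 - t) * l * c) * (A / (2 * ((1-t)*l) * c)) = t * A" for A
        using l c by simp
      show ?thesis unfolding distrib_left 1 2 by (simp add: algebra_simps power2_eq_square)
    qed
    finally show ?thesis unfolding l_def[symmetric] c_def[symmetric]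
      by (simp add: algebra_simps power2_eq_square)
  qed
qed

section \<open>Geodesics\<close>

text \<open>Applied to a path as long as the distance of its endpoints, this forces equality in the
  triangle inequality along the path.\<close>

lemma curve_length_ge_four_points:
  fixes \<gamma> :: "real \<Rightarrow> 'a::metric_space"
  assumes "a \<le> s" "s \<le> t" "t \<le> b"
  shows "ereal (dist (\<gamma> a) (\<gamma> s) + dist (\<gamma> s) (\<gamma> t) + dist (\<gamma> t) (\<gamma> b)) \<le> curve_length {a..b} \<gamma>"
proof -
  define \<tau> :: "nat \<Rightarrow> real" where "\<tau> i = (if i = 0 then a else if i = 1 then s else if i = 2 then t else b)" for i
  have "(3, \<tau>) \<in> {(n, t :: nat \<Rightarrow> real). 1 \<le> n \<and> (\<forall>i\<le>n. t i \<in> {a..b}) \<and> (\<forall>i<n. t i \<le> t (Suc i))}"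
    using assms by (auto simp: \<tau>_def)
  then have "(case (3, \<tau>) of (n, t) \<Rightarrow> ereal (\<Sum>i<n. dist (\<gamma> (t i)) (\<gamma> (t (Suc i))))) \<le> curve_length {a..b} \<gamma>"
    unfolding curve_length_def by (rule SUP_upper)
  then show ?thesis by (simp add: numeral_3_eq_3 \<tau>_def)
qed

text \<open>Along a shortest path c, the function \<phi> = d(x, c) is continuous and nondecreasing,
  and its increments are the distances between points of c. By the intermediate value theorem some
  \<sigma> u satisfies \<phi> (\<sigma> u) = u d(x,y). The choice \<sigma> may jump where \<phi> is
  constant, but c is constant there too, so c composed with \<sigma> has constant speed.\<close>

lemma geodesic_exists:
  fixes x y :: "'a::metric_space"
  assumes "geodesic_space TYPE('a)"
  obtains \<gamma> :: "real \<Rightarrow> 'a" where "geodesic \<gamma>" "\<gamma> 0 = x" "\<gamma> 1 = y"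
proof -
  have "ereal (dist x y) \<in> connecting_lengths x y"
    using assms by (auto simp: geodesic_space_def)
  then obtain a b c where ab: "a \<le> b" and cont: "continuous_on {a..b} c"
    and ends: "c a = x" "c b = y" and len: "curve_length {a..b} c = ereal (dist x y)"
    unfolding connecting_lengths_def by auto
  define d where "d = dist x y"
  define \<phi> where "\<phi> s = dist x (c s)" for s
  have \<phi>: "dist (c s) (c t) = \<phi> t - \<phi> s" if "a \<le> s" "s \<le> t" "t \<le> b" for s t
  proof -
    have "dist x (c s) + dist (c s) (c t) + dist (c t) y \<le> dist x y"
      using curve_length_ge_four_points[OF that, of c] len ends by simp
    moreover have "dist x y \<le> dist x (c t) + dist (c t) y"
      "dist x (c t) \<le> dist x (c s) + dist (c s) (c t)" by (rule dist_triangle)+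
    ultimately show ?thesis by (simp add: \<phi>_def)
  qed
  have \<phi>_abs: "dist (c s) (c t) = \<bar>\<phi> t - \<phi> s\<bar>" if "s \<in> {a..b}" "t \<in> {a..b}" for s t
  proof (cases "s \<le> t")
    case True
    then have "dist (c s) (c t) = \<phi> t - \<phi> s" using \<phi>[of s t] that by auto
    moreover have "dist (c s) (c t) \<ge> 0" by simp
    ultimately show ?thesis by linarith
  next
    case False
    then have "dist (c t) (c s) = \<phi> s - \<phi> t" using \<phi>[of t s] that by auto
    moreover have "dist (c t) (c s) \<ge> 0" by simp
    ultimately show ?thesis by (subst dist_commute) linarith
  qed
  have \<phi>_ends: "\<phi> a = 0" "\<phi> b = d" by (auto simp: \<phi>_def ends d_def)
  have "\<exists>s. a \<le> s \<and> s \<le> b \<and> \<phi> s = u * d" if "0 \<le> u" "u \<le> 1" for u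
  proof (rule IVT')
    show "\<phi> a \<le> u * d" using that by (auto simp: \<phi>_ends d_def)
    show "u * d \<le> \<phi> b" using that by (auto simp: \<phi>_ends d_def mult_left_le_one_le)
    show "continuous_on {a..b} \<phi>" unfolding \<phi>_def by (intro continuous_intros cont)
  qed (rule ab)
  then obtain \<sigma> where \<sigma>: "a \<le> \<sigma> u \<and> \<sigma> u \<le> b \<and> \<phi> (\<sigma> u) = u * d" if "0 \<le> u" "u \<le> 1" for u
    by metis
  have dist_\<sigma>: "dist (c (\<sigma> s)) (c (\<sigma> t)) = \<bar>t * d - s * d\<bar>" if "0 \<le> s" "s \<le> 1" "0 \<le> t" "t \<le> 1" for s t
    using \<phi>_abs[of "\<sigma> s" "\<sigma> t"] \<sigma>[of s] \<sigma>[of t] that by auto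
  have "dist (c (\<sigma> 0)) x = 0"
    using \<sigma>[of 0] by (auto simp: \<phi>_def dist_commute)
  then have 0: "c (\<sigma> 0) = x" by simp
  have "dist (c (\<sigma> 1)) (c b) = 0"
    using \<phi>_abs[of "\<sigma> 1" b] \<sigma>[of 1] ab \<phi>_ends by simp
  then have 1: "c (\<sigma> 1) = y" using ends by simp
  have "geodesic (\<lambda>t. c (\<sigma> t))"
    unfolding geodesic_def
  proof (intro allI impI, elim conjE)
    fix s t :: real assume st: "0 \<le> s" "s \<le> t" "t \<le> 1"
    have "d \<ge> 0" by (simp add: d_def)
    then have "\<bar>t * d - s * d\<bar> = (t - s) * d" using st by (simp add: abs_mult flip: left_diff_distrib)
    then show "dist (c (\<sigma> s)) (c (\<sigma> t)) = (t - s) * dist (c (\<sigma> 0)) (c (\<sigma> 1))"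
      using dist_\<sigma>[of s t] st by (simp add: 0 1 d_def)
  qed
  then show thesis using that 0 1 by blast
qed

lemma geodesic_dist:
  assumes "geodesic \<gamma>" "0 \<le> t" "t \<le> 1"
  shows "dist (\<gamma> 0) (\<gamma> t) = t * dist (\<gamma> 0) (\<gamma> 1)"
    and "dist (\<gamma> t) (\<gamma> 1) = (1 - t) * dist (\<gamma> 0) (\<gamma> 1)"
  using assms unfolding geodesic_def by (metis diff_zero order_refl)+

lemma geodesically_convexD:
  assumes f: "geodesically_convex \<alpha> f" and \<gamma>: "geodesic \<gamma>" and t: "0 \<le> t" "t \<le> 1"
  shows "f (\<gamma> t) \<le> (1 - t) * f (\<gamma> 0) + t * f (\<gamma> 1) - \<alpha> / 2 * (t * (1 - t) * (dist (\<gamma> 0) (\<gamma> 1))\<^sup>2)"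
proof -
  have cv: "convex_on {0..1} (\<lambda>t. f (\<gamma> t) - \<alpha> / 2 * (dist (\<gamma> 0) (\<gamma> t))\<^sup>2)"
    using f \<gamma> by (simp add: geodesically_convex_def)
  have "f (\<gamma> t) - \<alpha> / 2 * (dist (\<gamma> 0) (\<gamma> t))\<^sup>2 \<le>
     (1 - t) * f (\<gamma> 0) + t * (f (\<gamma> 1) - \<alpha> / 2 * (dist (\<gamma> 0) (\<gamma> 1))\<^sup>2)"
    using convex_onD[OF cv, of t 0 1] t by simp
  moreover have "(dist (\<gamma> 0) (\<gamma> t))\<^sup>2 = t\<^sup>2 * (dist (\<gamma> 0) (\<gamma> 1))\<^sup>2"
    by (simp add: geodesic_dist(1)[OF \<gamma> t] power_mult_distrib)
  ultimately show ?thesis by (simp add: algebra_simps power2_eq_square)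
qed

section \<open>A lower bound near the barycenter\<close>

text \<open>With a = \<open>g t\<close>, the point z has parameter u on a geodesic from a to x.
  \<open>sq_dist_semiconcave\<close> is used twice: at a inside [p,q], seen from z, it bounds d(p,z)
  above in terms of d(q,z); at z inside [a,x], seen from q, it bounds d(q,z) below in terms of
  d(q,x). The second bound is inserted into the first.\<close>

lemma descent_step:
  fixes p q x :: "'a::metric_space" and t u :: real
  assumes gs: "geodesic_space TYPE('a)"
    and curv: "curvature_bounded_below TYPE('a) \<kappa>"
    and \<rho>: "\<kappa> > 0 \<longrightarrow> \<rho> * sqrt \<kappa> \<le> 1"
    and f: "geodesically_convex \<alpha> f"
    and near: "dist p q \<le> \<rho> / 4" "dist p x \<le> \<rho> / 4"
    and g: "geodesic g" "g 0 = p" "g 1 = q"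
    and t: "0 \<le> t" "t \<le> 1" and u: "0 \<le> u" "u \<le> 1"
  obtains z where
    "dist (g t) z = u * dist (g t) x"
    "(1 - t) * ((dist p z)\<^sup>2 - (t * dist p q)\<^sup>2)
       \<le> u\<^sup>2 * (dist (g t) x)\<^sup>2 * (1 + 4 * \<bar>\<kappa>\<bar> * (t * (1 - t) * (dist p q)\<^sup>2))
        + t * u * ((1 - t)\<^sup>2 * (dist p q)\<^sup>2 - (dist q x)\<^sup>2
                   + (1 - u) * (1 + 4 * \<bar>\<kappa>\<bar> * (dist z q)\<^sup>2) * (dist (g t) x)\<^sup>2)"
    "f z \<le> (1 - u) * f (g t) + u * f x - \<alpha> / 2 * (u * (1 - u) * (dist (g t) x)\<^sup>2)"
proof -
  define a where "a = g t"
  define h where "h = dist p q"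
  define L where "L = dist a x"
  obtain \<sigma> :: "real \<Rightarrow> 'a" where \<sigma>: "geodesic \<sigma>" "\<sigma> 0 = a" "\<sigma> 1 = x"
    using geodesic_exists[OF gs] by blast
  define z where "z = \<sigma> u"
  have pa: "dist p a = t * h" and aq: "dist a q = (1 - t) * h"
    using geodesic_dist[OF g(1) t] g by (auto simp: a_def h_def)
  have az: "dist a z = u * L" and zx: "dist z x = (1 - u) * L"
    using geodesic_dist[OF \<sigma>(1) u] \<sigma> by (auto simp: L_def z_def)
  have r0: "0 \<le> \<rho>" using near(1) zero_le_dist[of p q] by linarith
  have "t * h \<le> h" "(1 - t) * h \<le> h" using t by (auto simp: h_def mult_left_le_one_le)
  then have b1: "dist p a \<le> \<rho> / 4" "dist a q \<le> \<rho> / 4" using pa aq near by (auto simp: h_def)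
  have b2: "L \<le> \<rho> / 2" using dist_triangle3[of a x p] b1 near by (simp add: L_def)
  have "u * L \<le> L" "(1 - u) * L \<le> L" using u by (auto simp: L_def mult_left_le_one_le)
  then have b3: "dist a z \<le> \<rho> / 2" "dist z x \<le> \<rho> / 2" using az zx b2 by auto
  have b4: "dist p z \<le> 3 / 4 * \<rho>" "dist z q \<le> 3 / 4 * \<rho>" "dist a x \<le> \<rho> / 2" "dist x q \<le> \<rho>"
    using dist_triangle[of p z a] dist_triangle[of z q a] dist_triangle3[of x q p] b1 b2 b3 near r0
    by (auto simp: dist_commute L_def)
  have I1: "(1 - t) * (dist p z)\<^sup>2 + t * (dist q z)\<^sup>2
      - (1 + 4 * \<bar>\<kappa>\<bar> * (dist a z)\<^sup>2) * (t * (1 - t) * (dist p q)\<^sup>2) \<le> (dist a z)\<^sup>2"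
    using near b1 b3 b4 r0 \<rho> t pa aq
    by (intro sq_dist_semiconcave[OF curv, where \<rho> = \<rho>]) (auto simp: h_def dist_commute)
  have I2: "(1 - u) * (dist a q)\<^sup>2 + u * (dist x q)\<^sup>2
      - (1 + 4 * \<bar>\<kappa>\<bar> * (dist z q)\<^sup>2) * (u * (1 - u) * (dist a x)\<^sup>2) \<le> (dist z q)\<^sup>2"
    using near b1 b3 b4 r0 \<rho> u az zx
    by (intro sq_dist_semiconcave[OF curv, where \<rho> = \<rho>]) (auto simp: L_def dist_commute)
  define K where "K = 1 + 4 * \<bar>\<kappa>\<bar> * (dist z q)\<^sup>2"
  have "(1 - t) * (dist p z)\<^sup>2 + t * (dist z q)\<^sup>2
      - (1 + 4 * \<bar>\<kappa>\<bar> * (u * L)\<^sup>2) * (t * (1 - t) * h\<^sup>2) \<le> (u * L)\<^sup>2"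
    using I1 unfolding az h_def[symmetric] by (simp only: dist_commute[of q z])
  moreover have "t * ((1 - u) * ((1 - t) * h)\<^sup>2 + u * (dist q x)\<^sup>2 - K * (u * (1 - u) * L\<^sup>2)) \<le> t * (dist z q)\<^sup>2"
    using I2 t unfolding aq L_def[symmetric] K_def[symmetric]
    by (intro mult_left_mono) (auto simp: dist_commute)
  ultimately have main: "(1 - t) * ((dist p z)\<^sup>2 - (t * h)\<^sup>2)
       \<le> u\<^sup>2 * L\<^sup>2 * (1 + 4 * \<bar>\<kappa>\<bar> * (t * (1 - t) * h\<^sup>2))
        + t * u * ((1 - t)\<^sup>2 * h\<^sup>2 - (dist q x)\<^sup>2 + (1 - u) * K * L\<^sup>2)"
    by (simp add: algebra_simps power2_eq_square)
  show thesis
  proof (rule that[of z])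
    show "dist (g t) z = u * dist (g t) x" using az by (simp add: a_def L_def)
    show "f z \<le> (1 - u) * f (g t) + u * f x - \<alpha> / 2 * (u * (1 - u) * (dist (g t) x)\<^sup>2)"
      using geodesically_convexD[OF f \<sigma>(1) u] \<sigma> by (simp add: z_def a_def)
  qed (use main in \<open>simp add: a_def L_def h_def K_def\<close>)
qed

text \<open>The bound is the limit \<open>t \<rightarrow> 0\<close> of \<open>descent_step\<close> with \<open>u = \<theta> d(p,q) t\<close>.\<close>
lemma local_lower_bound:
  fixes p q x :: "'a::metric_space"
  assumes gs: "geodesic_space TYPE('a)"
    and curv: "curvature_bounded_below TYPE('a) \<kappa>"
    and \<rho>: "\<kappa> > 0 \<longrightarrow> \<rho> * sqrt \<kappa> \<le> 1"
    and f: "geodesically_convex \<alpha> f"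
    and near: "dist p q \<le> \<rho> / 4" "dist p x \<le> \<rho> / 4"
    and pos: "p \<noteq> q" "0 \<le> s" "0 \<le> \<delta>" "0 < \<theta>"
    and slope: "\<And>y. f p - s * dist p y + \<alpha> / 2 * (dist p y)\<^sup>2 \<le> f y"
    and fq: "f q \<le> f p - (s - \<delta>) * dist p q + \<alpha> / 2 * (dist p q)\<^sup>2"
  shows "f p - s / (2 * dist p q) * ((dist p x)\<^sup>2 - (dist q x)\<^sup>2)
      - s / 2 * (\<theta> * (dist p x)\<^sup>2 + dist p q + 4 * \<bar>\<kappa>\<bar> * dist p q * (dist p x)\<^sup>2)
      - \<delta> / \<theta> + \<alpha> / 2 * (dist p x)\<^sup>2 \<le> f x"
proof -
  define h where "h = dist p q"
  define R where "R = dist p x"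
  define C where "C = 4 * \<bar>\<kappa>\<bar>"
  define \<eta> where "\<eta> = h * \<theta>"
  have h: "h > 0" and \<eta>: "\<eta> > 0" using pos by (auto simp: h_def \<eta>_def)
  obtain g :: "real \<Rightarrow> 'a" where g: "geodesic g" "g 0 = p" "g 1 = q"
    using geodesic_exists[OF gs] by blast
  define L where "L t = dist (g t) x" for t
  \<comment> \<open>For 0 < t < m both t and u = \<eta> t are admissible parameters.\<close>
  define m where "m = min (1/2) (1 / \<eta>)"
  have m: "m > 0" using \<eta> by (simp add: m_def)
  have um: "0 < \<eta> * t" "\<eta> * t < 1" "t < 1" if "0 < t" "t < m" for t
    using that \<eta> by (auto simp: m_def field_simps)
  have "\<exists>z. dist (g t) z = (\<eta> * t) * dist (g t) x \<and>
    (1 - t) * ((dist p z)\<^sup>2 - (t * dist p q)\<^sup>2)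
       \<le> (\<eta> * t)\<^sup>2 * (dist (g t) x)\<^sup>2 * (1 + 4 * \<bar>\<kappa>\<bar> * (t * (1 - t) * (dist p q)\<^sup>2))
        + t * (\<eta> * t) * ((1 - t)\<^sup>2 * (dist p q)\<^sup>2 - (dist q x)\<^sup>2
                   + (1 - (\<eta> * t)) * (1 + 4 * \<bar>\<kappa>\<bar> * (dist z q)\<^sup>2) * (dist (g t) x)\<^sup>2) \<and>
    f z \<le> (1 - (\<eta> * t)) * f (g t) + (\<eta> * t) * f x - \<alpha> / 2 * ((\<eta> * t) * (1 - (\<eta> * t)) * (dist (g t) x)\<^sup>2)"
    if t: "0 < t" "t < m" for t
    using descent_step[OF gs curv \<rho> f near g, of t "\<eta> * t"] um[OF t] t by fastforce
  then obtain z where z: "\<And>t. 0 < t \<Longrightarrow> t < m \<Longrightarrow> dist (g t) (z t) = (\<eta> * t) * L t"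
    "\<And>t. 0 < t \<Longrightarrow> t < m \<Longrightarrow> (1 - t) * ((dist p (z t))\<^sup>2 - (t * h)\<^sup>2)
       \<le> (\<eta> * t)\<^sup>2 * (L t)\<^sup>2 * (1 + C * (t * (1 - t) * h\<^sup>2))
        + t * (\<eta> * t) * ((1 - t)\<^sup>2 * h\<^sup>2 - (dist q x)\<^sup>2
                   + (1 - (\<eta> * t)) * (1 + C * (dist (z t) q)\<^sup>2) * (L t)\<^sup>2)"
    "\<And>t. 0 < t \<Longrightarrow> t < m \<Longrightarrow> f (z t) \<le> (1 - (\<eta> * t)) * f (g t) + (\<eta> * t) * f x
       - \<alpha> / 2 * ((\<eta> * t) * (1 - (\<eta> * t)) * (L t)\<^sup>2)"
    unfolding h_def L_def C_def by metis
  \<comment> \<open>With u = \<eta> t, the factor t u is taken out of the bound of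
    \<open>descent_step\<close>, so that (1 - t) (d(p,z)^2 - (t h)^2) \<le> t u B.\<close>
  define B where "B t = \<eta> * (L t)\<^sup>2 * (1 + C * (t * (1 - t) * h\<^sup>2)) + (1 - t)\<^sup>2 * h\<^sup>2 - (dist q x)\<^sup>2
                   + (1 - \<eta> * t) * (1 + C * (dist (z t) q)\<^sup>2) * (L t)\<^sup>2" for t
  define D where "D t = dist p (z t)" for t
  \<comment> \<open>This quotient is multiplied by \<alpha> / 2, whose sign is unknown, so a
    one-sided bound would not do: it has to tend to 0.\<close>
  define E where "E t = ((D t)\<^sup>2 - (t * h)\<^sup>2) / (\<eta> * t)" for t
  have pg: "dist p (g t) = t * h" "dist (g t) q = (1 - t) * h" if "0 < t" "t < m" for t
    using geodesic_dist[OF g(1), of t] g um[OF that] that by (auto simp: h_def)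
  have D_diff: "\<bar>D t - t * h\<bar> \<le> \<eta> * t * L t" if t: "0 < t" "t < m" for t
    using dist_triangle[of p "z t" "g t"] dist_triangle[of p "g t" "z t"] z(1)[OF t] pg(1)[OF t]
    by (auto simp: D_def dist_commute abs_le_iff)
  have step: "f x \<ge> f p - s * (B t / (2 * h * (1 - t))) - \<delta> / \<theta> - s * t * h
       + \<alpha> / 2 * (E t + t\<^sup>2 * h\<^sup>2 + (1 - \<eta> * t) * (L t)\<^sup>2)" if t: "0 < t" "t < m" for t
  proof -
    define u where "u = \<eta> * t"
    define W where "W = B t / (2 * h * (1 - t))"
    define \<beta> where "\<beta> = \<alpha> / 2"
    have u: "0 < u" "u < 1" "t < 1" using um[OF t] by (auto simp: u_def)
    have "(1 - t) * ((D t)\<^sup>2 - (t * h)\<^sup>2) \<le> t * u * B t"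
      using z(2)[OF t] by (simp add: D_def B_def u_def power2_eq_square algebra_simps)
    then have "(D t)\<^sup>2 - (t * h)\<^sup>2 \<le> t * u * B t / (1 - t)"
      using u by (simp add: field_simps)
    moreover have "2 * (t * h) * (D t - t * h) \<le> (D t)\<^sup>2 - (t * h)\<^sup>2"
      using zero_le_power2[of "D t - t * h"] by (simp add: power2_eq_square algebra_simps)
    ultimately have "2 * (t * h) * (D t - t * h) \<le> t * u * B t / (1 - t)" by linarith
    then have "t * (2 * h * (D t - t * h)) \<le> t * (u * B t / (1 - t))" by (simp add: mult_ac)
    then have "2 * h * (D t - t * h) \<le> u * B t / (1 - t)"
      using t by (simp only: mult_le_cancel_left_pos)
    then have D: "D t - t * h \<le> u * (B t / (2 * h * (1 - t)))"
      using h u by (simp add: field_simps)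
    have Eu: "u * E t = (D t)\<^sup>2 - (t * h)\<^sup>2" using u by (simp add: E_def flip: u_def)
    have "f (g t) \<le> (1 - t) * f p + t * f q - \<alpha> / 2 * (t * (1 - t) * h\<^sup>2)"
      using geodesically_convexD[OF f g(1), of t] g t u by (simp add: h_def)
    also have "\<dots> \<le> (1 - t) * f p + t * (f p - (s - \<delta>) * h + \<alpha> / 2 * h\<^sup>2) - \<alpha> / 2 * (t * (1 - t) * h\<^sup>2)"
      using fq t by (intro diff_right_mono add_left_mono mult_left_mono) (auto simp: h_def)
    also have "\<dots> = f p - (s - \<delta>) * (t * h) + \<alpha> / 2 * (t * h)\<^sup>2"
      by (simp add: field_simps power2_eq_square)
    finally have "(1 - u) * f (g t) \<le> (1 - u) * (f p - (s - \<delta>) * (t * h) + \<alpha> / 2 * (t * h)\<^sup>2)"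
      using u by (intro mult_left_mono) auto
    moreover have "f p - s * D t + \<alpha> / 2 * (D t)\<^sup>2 \<le> f (z t)"
      using slope[of "z t"] by (simp add: D_def)
    moreover have "f (z t) \<le> (1 - u) * f (g t) + u * f x - \<alpha> / 2 * (u * (1 - u) * (L t)\<^sup>2)"
      using z(3)[OF t] by (simp add: u_def)
    moreover have "s * (D t - t * h) \<le> s * (u * (B t / (2 * h * (1 - t))))"
      using D pos by (intro mult_left_mono) auto
    moreover have "0 \<le> u * (\<delta> * (t * h))" using u pos t h by simp
    \<comment> \<open>The slope bound at z contributes - s d(p,z) and the near-optimal slope at
      \<open>g t\<close> contributes s t h; these cancel to first order. What remains is of order u,
      except \<delta> t h, and this equals u \<delta> / \<theta> because u = \<theta> h t. So u can
      be divided out.\<close>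
    ultimately have "u * f x \<ge> u * f p - s * (u * (B t / (2 * h * (1 - t)))) - \<delta> * (t * h) - u * (s * (t * h))
       + \<alpha> / 2 * (((D t)\<^sup>2 - (t * h)\<^sup>2) + u * (t * h)\<^sup>2 + u * (1 - u) * (L t)\<^sup>2)"
      unfolding W_def[symmetric] \<beta>_def[symmetric] by (simp add: algebra_simps power2_eq_square)
    moreover have "\<delta> * (t * h) = u * (\<delta> / \<theta>)"
      using pos by (simp add: u_def \<eta>_def)
    ultimately have "u * f x \<ge> u * (f p - s * (B t / (2 * h * (1 - t))) - \<delta> / \<theta> - s * t * h
       + \<alpha> / 2 * (E t + t\<^sup>2 * h\<^sup>2 + (1 - u) * (L t)\<^sup>2))"
      unfolding Eu[symmetric] by (simp add: algebra_simps power2_eq_square)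
    then show ?thesis using u unfolding u_def[symmetric] by (simp only: mult_le_cancel_left_pos)
  qed
  \<comment> \<open>As t tends to 0, both \<open>g t\<close> and \<open>z t\<close> tend to p, which
    determines the limit of every quantity in \<open>step\<close>.\<close>
  have ev: "\<forall>\<^sub>F t in at_right 0. 0 < t \<and> t < m"
    using m by (auto simp: eventually_at_right[OF zero_less_one])
  have id: "((\<lambda>t. t) \<longlongrightarrow> 0) (at_right (0::real))" by (rule tendsto_ident_at)
  have L: "(L \<longlongrightarrow> R) (at_right 0)"
  proof (rule LIM_zero_cancel, rule Lim_null_comparison)
    show "\<forall>\<^sub>F t in at_right 0. norm (L t - R) \<le> t * h"
      using ev
    proof eventually_elim
      case (elim t)
      then show ?case using dist_triangle[of p x "g t"] dist_triangle3[of "g t" x p] pg(1)[of t]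
        by (auto simp: L_def R_def abs_le_iff)
    qed
    show "((\<lambda>t. t * h) \<longlongrightarrow> 0) (at_right 0)" using tendsto_mult_left_zero[OF id] .
  qed
  have D: "(D \<longlongrightarrow> 0) (at_right 0)"
  proof (rule Lim_null_comparison)
    show "\<forall>\<^sub>F t in at_right 0. norm (D t) \<le> t * h + \<eta> * t * L t"
      using ev
    proof eventually_elim
      case (elim t)
      then show ?case using D_diff[of t] by (auto simp: D_def abs_le_iff)
    qed
    have "((\<lambda>t. t * h + \<eta> * t * L t) \<longlongrightarrow> 0 * h + \<eta> * 0 * R) (at_right 0)"
      by (intro tendsto_intros L id)
    then show "((\<lambda>t. t * h + \<eta> * t * L t) \<longlongrightarrow> 0) (at_right 0)" by simp
  qed
  have E: "(E \<longlongrightarrow> 0) (at_right 0)"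
  proof (rule Lim_null_comparison)
    show "\<forall>\<^sub>F t in at_right 0. norm (E t) \<le> L t * (D t + t * h)"
      using ev
    proof eventually_elim
      case (elim t)
      have u: "0 < \<eta> * t" using um elim by auto
      have "\<bar>(D t)\<^sup>2 - (t * h)\<^sup>2\<bar> = \<bar>D t - t * h\<bar> * (D t + t * h)"
        using elim h by (simp add: D_def abs_mult square_diff_square_factored power2_eq_square mult.commute)
      also have "\<dots> \<le> \<eta> * t * L t * (D t + t * h)"
        using elim h by (intro mult_right_mono D_diff) (auto simp: D_def)
      finally show ?case using u by (simp add: E_def field_simps)
    qed
    have "((\<lambda>t. L t * (D t + t * h)) \<longlongrightarrow> R * (0 + 0 * h)) (at_right 0)"
      by (intro tendsto_intros L D id)
    then show "((\<lambda>t. L t * (D t + t * h)) \<longlongrightarrow> 0) (at_right 0)" by simp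
  qed
  have zq: "((\<lambda>t. dist (z t) q) \<longlongrightarrow> h) (at_right 0)"
  proof (rule LIM_zero_cancel, rule Lim_null_comparison)
    show "\<forall>\<^sub>F t in at_right 0. norm (dist (z t) q - h) \<le> D t"
      using ev
    proof eventually_elim
      case (elim t)
      then show ?case using dist_triangle[of p q "z t"] dist_triangle3[of "z t" q p]
        by (auto simp: D_def h_def abs_le_iff)
    qed
  qed (rule D)
  have "((\<lambda>t. f p - s * (B t / (2 * h * (1 - t))) - \<delta> / \<theta> - s * t * h
       + \<alpha> / 2 * (E t + t\<^sup>2 * h\<^sup>2 + (1 - \<eta> * t) * (L t)\<^sup>2)) \<longlongrightarrow>
     f p - s * ((\<eta> * R\<^sup>2 * (1 + C * (0 * (1 - 0) * h\<^sup>2)) + (1 - 0)\<^sup>2 * h\<^sup>2 - (dist q x)\<^sup>2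
                   + (1 - \<eta> * 0) * (1 + C * h\<^sup>2) * R\<^sup>2) / (2 * h * (1 - 0))) - \<delta> / \<theta> - s * 0 * h
       + \<alpha> / 2 * (0 + 0\<^sup>2 * h\<^sup>2 + (1 - \<eta> * 0) * R\<^sup>2)) (at_right 0)"
    unfolding B_def using h by (intro tendsto_intros L E zq id) auto
  moreover have "\<forall>\<^sub>F t in at_right 0. f p - s * (B t / (2 * h * (1 - t))) - \<delta> / \<theta> - s * t * h
       + \<alpha> / 2 * (E t + t\<^sup>2 * h\<^sup>2 + (1 - \<eta> * t) * (L t)\<^sup>2) \<le> f x"
    using ev by eventually_elim (use step in blast)
  ultimately have "f p - s * ((\<eta> * R\<^sup>2 + h\<^sup>2 - (dist q x)\<^sup>2 + (1 + C * h\<^sup>2) * R\<^sup>2) / (2 * h)) - \<delta> / \<theta>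
       + \<alpha> / 2 * R\<^sup>2 \<le> f x"
    by (intro tendsto_upperbound) auto
  moreover have "s * ((\<eta> * R\<^sup>2 + h\<^sup>2 - (dist q x)\<^sup>2 + (1 + C * h\<^sup>2) * R\<^sup>2) / (2 * h))
     = s / (2 * h) * (R\<^sup>2 - (dist q x)\<^sup>2) + s / 2 * (\<theta> * R\<^sup>2 + h + C * h * R\<^sup>2)"
    using h by (simp add: \<eta>_def field_simps power2_eq_square)
  ultimately show ?thesis by (simp add: h_def R_def C_def)
qed

section \<open>Descent rates and the Jensen inequality\<close>

text \<open>The slope s with f y = f p - s d(p,y) + \<alpha> d(p,y)^2 / 2, considered only for y
  different from p.\<close>

definition descent_rate :: "real \<Rightarrow> ('a::metric_space \<Rightarrow> real) \<Rightarrow> 'a \<Rightarrow> 'a \<Rightarrow> real" where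
  "descent_rate \<alpha> f p y = (f p - f y) / dist p y + \<alpha> / 2 * dist p y"

lemma descent_rate_le_iff:
  assumes "p \<noteq> y"
  shows "descent_rate \<alpha> f p y \<le> s \<longleftrightarrow> f p - s * dist p y + \<alpha> / 2 * (dist p y)\<^sup>2 \<le> f y"
    and "s \<le> descent_rate \<alpha> f p y \<longleftrightarrow> f y \<le> f p - s * dist p y + \<alpha> / 2 * (dist p y)\<^sup>2"
  using assms by (auto simp: descent_rate_def field_simps power2_eq_square)

text \<open>Monotonicity of the chord slopes of a convex function: moving the endpoint towards p
  along a geodesic does not lower the rate. Hence the supremum of the rates is already determined
  near p.\<close>

lemma descent_rate_geodesic:
  assumes f: "geodesically_convex \<alpha> f" and g: "geodesic g" and ne: "g 0 \<noteq> g 1"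
    and t: "0 < t" "t \<le> 1"
  shows "descent_rate \<alpha> f (g 0) (g 1) \<le> descent_rate \<alpha> f (g 0) (g t)"
proof -
  define d where "d = dist (g 0) (g 1)"
  define F where "F = descent_rate \<alpha> f (g 0) (g 1)"
  have d: "d > 0" using ne by (simp add: d_def)
  have td: "dist (g 0) (g t) = t * d" using geodesic_dist(1)[OF g, of t] t by (simp add: d_def)
  then have "g 0 \<noteq> g t" using d t by auto
  moreover have "f (g 1) \<le> f (g 0) - F * d + \<alpha> / 2 * d\<^sup>2"
    using descent_rate_le_iff(2)[OF ne, of F \<alpha> f] by (simp add: F_def d_def)
  then have "t * f (g 1) \<le> t * (f (g 0) - F * d + \<alpha> / 2 * d\<^sup>2)"
    using t by (intro mult_left_mono) auto
  then have "f (g t) \<le> f (g 0) - F * (t * d) + \<alpha> / 2 * (t * d)\<^sup>2"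
    using geodesically_convexD[OF f g, of t] t
    by (simp add: d_def[symmetric] algebra_simps power2_eq_square)
  ultimately show ?thesis
    using descent_rate_le_iff(2)[of "g 0" "g t" F \<alpha> f] by (simp add: td F_def)
qed

text \<open>By \<open>descent_rate_geodesic\<close>, the rate at y is at most the rate at a point of
  [p,y] in a ball where f is Lipschitz.\<close>

lemma descent_rate_bdd_above:
  fixes f :: "'a::metric_space \<Rightarrow> real"
  assumes gs: "geodesic_space TYPE('a)" and f: "geodesically_convex \<alpha> f"
    and lip: "locally_lipschitz_at f p"
  shows "bdd_above (descent_rate \<alpha> f p ` (- {p}))"
proof -
  obtain L U where L: "L > 0" "open U" "p \<in> U" "L-lipschitz_on U f"
    using lip by (auto simp: locally_lipschitz_at_def)
  then obtain e where e: "e > 0" "ball p e \<subseteq> U" by (meson open_contains_ball)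
  have "descent_rate \<alpha> f p y \<le> L + \<bar>\<alpha>\<bar> / 2 * e" if "y \<noteq> p" for y
  proof -
    obtain g :: "real \<Rightarrow> 'a" where g: "geodesic g" "g 0 = p" "g 1 = y"
      using geodesic_exists[OF gs] by blast
    define d where "d = dist p y"
    have d: "d > 0" using that by (simp add: d_def)
    define t where "t = min 1 (e / (2 * d))"
    have t: "0 < t" "t \<le> 1" "t * d < e"
      using d e by (auto simp: t_def min_def field_simps)
    have td: "dist p (g t) = t * d" using geodesic_dist(1)[OF g(1), of t] g t by (simp add: d_def)
    have ne: "p \<noteq> g t" using td d t by auto
    have "dist p (g t) < e" using td t by simp
    then have "g t \<in> U" using e by auto
    then have "f p - f (g t) \<le> L * dist p (g t)"
      using lipschitz_onD[OF L(4), of p "g t"] L by (auto simp: dist_real_def)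
    then have "(f p - f (g t)) / dist p (g t) \<le> L" using ne by (simp add: field_simps)
    moreover have "\<alpha> / 2 * dist p (g t) \<le> \<bar>\<alpha>\<bar> / 2 * e"
      using t td e d by (intro mult_mono) auto
    ultimately have "descent_rate \<alpha> f p (g t) \<le> L + \<bar>\<alpha>\<bar> / 2 * e"
      by (simp add: descent_rate_def)
    then show ?thesis using descent_rate_geodesic[OF f g(1), of t] g that t by auto
  qed
  then show ?thesis by (intro bdd_aboveI2) auto
qed

text \<open>Here s is the supremum of the descent rates. The assumption on y provides a nonnegative
  rate, hence s \<ge> 0, and an almost optimal point may be moved into the r-ball by
  \<open>descent_rate_geodesic\<close>.\<close>

lemma steepest_descent:
  fixes f :: "'a::metric_space \<Rightarrow> real"
  assumes gs: "geodesic_space TYPE('a)" and f: "geodesically_convex \<alpha> f"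
    and lip: "locally_lipschitz_at f p"
    and y: "f y < f p + \<alpha> / 2 * (dist p y)\<^sup>2"
  obtains s where "0 \<le> s" "\<And>y. f p - s * dist p y + \<alpha> / 2 * (dist p y)\<^sup>2 \<le> f y"
    "\<And>\<delta> r. 0 < \<delta> \<Longrightarrow> 0 < r \<Longrightarrow>
       \<exists>q. p \<noteq> q \<and> dist p q \<le> r \<and> f q \<le> f p - (s - \<delta>) * dist p q + \<alpha> / 2 * (dist p q)\<^sup>2"
proof -
  define F where "F = descent_rate \<alpha> f p"
  define s where "s = (SUP y\<in>-{p}. F y)"
  have bdd: "bdd_above (F ` (- {p}))"
    unfolding F_def by (rule descent_rate_bdd_above[OF gs f lip])
  have py: "p \<noteq> y" using y by auto
  have upper: "F z \<le> s" if "p \<noteq> z" for z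
    unfolding s_def using that bdd by (intro cSUP_upper) auto
  show thesis
  proof (rule that[of s])
    have "0 \<le> F y" using descent_rate_le_iff(2)[OF py, of 0 \<alpha> f] y by (simp add: F_def)
    then show "0 \<le> s" using upper[OF py] by linarith
    show "f p - s * dist p z + \<alpha> / 2 * (dist p z)\<^sup>2 \<le> f z" for z
    proof (cases "p = z")
      case False
      then show ?thesis using upper descent_rate_le_iff(1)[of p z \<alpha> f s] by (simp add: F_def)
    qed simp
    fix \<delta> r :: real assume \<delta>: "0 < \<delta>" and r: "0 < r"
    have "s - \<delta> < s" using \<delta> by simp
    moreover have "- {p} \<noteq> {}" using py by auto
    ultimately obtain w where w: "w \<noteq> p" "s - \<delta> < F w"
      using less_cSUP_iff[OF _ bdd, of "s - \<delta>"] unfolding s_def[symmetric] by auto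
    obtain g :: "real \<Rightarrow> 'a" where g: "geodesic g" "g 0 = p" "g 1 = w"
      using geodesic_exists[OF gs] by blast
    define d where "d = dist p w"
    have d: "d > 0" using w by (simp add: d_def)
    define t where "t = min 1 (r / d)"
    have t: "0 < t" "t \<le> 1" "t * d \<le> r"
      using d r by (auto simp: t_def min_def field_simps)
    have td: "dist p (g t) = t * d" using geodesic_dist(1)[OF g(1), of t] g t by (simp add: d_def)
    have ne: "p \<noteq> g t" using td d t by auto
    have "F w \<le> F (g t)" using descent_rate_geodesic[OF f g(1), of t] g w t by (auto simp: F_def)
    then have "s - \<delta> \<le> descent_rate \<alpha> f p (g t)" using w by (simp add: F_def)
    then show "\<exists>q. p \<noteq> q \<and> dist p q \<le> r \<and> f q \<le> f p - (s - \<delta>) * dist p q + \<alpha> / 2 * (dist p q)\<^sup>2"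
      using descent_rate_le_iff(2)[OF ne, of "s - \<delta>" \<alpha> f] ne td t by auto
  qed
qed

text \<open>Points \<open>x\<close> far from \<open>p\<close> are replaced by the point at parameter \<open>r / (r + d(p,x))\<close> on the
  geodesic from \<open>p\<close> to \<open>x\<close>, which lies in the \<open>r\<close>-ball where the curvature bound is applicable.\<close>
lemma lower_bound_at:
  fixes p q x :: "'a::metric_space"
  assumes gs: "geodesic_space TYPE('a)"
    and curv: "curvature_bounded_below TYPE('a) \<kappa>"
    and r: "0 < r" "\<kappa> > 0 \<longrightarrow> 4 * r * sqrt \<kappa> \<le> 1"
    and f: "geodesically_convex \<alpha> f"
    and q: "p \<noteq> q" "dist p q \<le> r" "dist p q \<le> \<theta>" and s: "0 \<le> s" and \<theta>: "0 < \<theta>"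
    and slope: "\<And>y. f p - s * dist p y + \<alpha> / 2 * (dist p y)\<^sup>2 \<le> f y"
    and fq: "f q \<le> f p - (s - \<theta>\<^sup>2) * dist p q + \<alpha> / 2 * (dist p q)\<^sup>2"
  shows "f p + \<alpha> / 2 * (dist p x)\<^sup>2 - s / (2 * dist p q) * ((dist p x)\<^sup>2 - (dist q x)\<^sup>2)
    - \<theta> * ((s / 2 + (s / 2 + 1) * (1 + 1 / r)) + (s / 2 * (1 + 4 * \<bar>\<kappa>\<bar>) + (s / 2 + 1) / r) * (dist p x)\<^sup>2) \<le> f x"
proof -
  obtain g :: "real \<Rightarrow> 'a" where g: "geodesic g" "g 0 = p" "g 1 = x"
    using geodesic_exists[OF gs] by blast
  define h where "h = dist p q"
  define R where "R = dist p x"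
  define d where "d = dist q x"
  define C where "C = 4 * \<bar>\<kappa>\<bar>"
  have h: "h > 0" "h \<le> \<theta>" using q by (auto simp: h_def)
  have R: "R \<ge> 0" and C: "C \<ge> 0" by (auto simp: R_def C_def)
  define t where "t = r / (r + R)"
  have t: "0 < t" "t \<le> 1" and inv_t: "1 / t = 1 + R / r" using r R by (auto simp: t_def field_simps)
  have tR: "t * R \<le> r" using r R by (simp add: t_def field_simps)
  define x' where "x' = g t"
  define d' where "d' = dist q x'"
  have px': "dist p x' = t * R" and x'x: "dist x' x = (1 - t) * R"
    using geodesic_dist[OF g(1), of t] g t by (auto simp: x'_def R_def)
  \<comment> \<open>The choice \<delta> = \<theta>^2 turns the error \<delta> / \<theta> into
    \<theta>.\<close>
  have "f p - s / (2 * dist p q) * ((dist p x')\<^sup>2 - (dist q x')\<^sup>2)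
      - s / 2 * (\<theta> * (dist p x')\<^sup>2 + dist p q + 4 * \<bar>\<kappa>\<bar> * dist p q * (dist p x')\<^sup>2)
      - \<theta>\<^sup>2 / \<theta> + \<alpha> / 2 * (dist p x')\<^sup>2 \<le> f x'"
    using q r tR px' s \<theta>
    by (intro local_lower_bound[OF gs curv _ f, where \<rho> = "4 * r"] slope fq) auto
  then have near: "f p - s / (2 * h) * ((t * R)\<^sup>2 - d'\<^sup>2)
      - s / 2 * (\<theta> * (t * R)\<^sup>2 + h + C * h * (t * R)\<^sup>2) - \<theta> + \<alpha> / 2 * (t * R)\<^sup>2 \<le> f x'"
    using \<theta> unfolding px' h_def[symmetric] d'_def[symmetric] C_def[symmetric]
    by (simp add: power2_eq_square)
  \<comment> \<open>Passing from x' to x: the difference of squared distances to p and q at x' is at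
    most t times that at x, up to t h^2.\<close>
  have "d \<le> d' + (1 - t) * R"
    using dist_triangle[of q x x'] x'x by (simp add: d_def d'_def)
  then have "t * R - d' \<le> R - d" by (simp add: algebra_simps)
  then have "2 * (t * R) * (t * R - d') \<le> 2 * (t * R) * (R - d)"
    using t R by (intro mult_left_mono) auto
  moreover have "(t * R)\<^sup>2 - d'\<^sup>2 \<le> 2 * (t * R) * (t * R - d')"
    using zero_le_power2[of "t * R - d'"] by (simp add: power2_eq_square algebra_simps)
  moreover have "2 * (t * R) * (R - d) \<le> t * (R\<^sup>2 - d\<^sup>2 + h\<^sup>2)"
  proof -
    have "\<bar>R - d\<bar> \<le> h" using abs_dist_diff_le[of p x q] by (simp add: R_def d_def h_def dist_commute)
    then have "(R - d)\<^sup>2 \<le> h\<^sup>2" by (metis abs_ge_zero power2_abs power_mono)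
    then have "2 * R * (R - d) \<le> R\<^sup>2 - d\<^sup>2 + h\<^sup>2" by (simp add: power2_eq_square algebra_simps)
    then show ?thesis using mult_left_mono[of "2 * R * (R - d)" "R\<^sup>2 - d\<^sup>2 + h\<^sup>2" t] t
      by (simp add: mult_ac)
  qed
  ultimately have "(t * R)\<^sup>2 - d'\<^sup>2 \<le> t * (R\<^sup>2 - d\<^sup>2 + h\<^sup>2)" by linarith
  then have "s / (2 * h) * ((t * R)\<^sup>2 - d'\<^sup>2) \<le> s / (2 * h) * (t * (R\<^sup>2 - d\<^sup>2 + h\<^sup>2))"
    using s h by (intro mult_left_mono) auto
  also have "\<dots> = t * (s / (2 * h) * (R\<^sup>2 - d\<^sup>2) + s / 2 * h)"
    using h by (simp add: field_simps power2_eq_square)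
  finally have main: "s / (2 * h) * ((t * R)\<^sup>2 - d'\<^sup>2) \<le> t * (s / (2 * h) * (R\<^sup>2 - d\<^sup>2) + s / 2 * h)" .
  \<comment> \<open>All terms need a factor t, to be divided out at the end. Constant errors obtain
    it from 1 = t (1 + R / r); then R \<le> 1 + R^2 makes the error quadratic in R, hence
    integrable.\<close>
  have tt: "1 = t * (1 + R / r)" using inv_t t by (simp add: field_simps)
  have tR2: "(t * R)\<^sup>2 \<le> t * R\<^sup>2"
    using t mult_right_mono[of "t * t" t "R * R"] by (simp add: power2_eq_square mult_ac mult_left_le_one_le)
  have "R / r \<le> (1 + R\<^sup>2) / r"
    using r(1) R zero_le_power2[of "R - 1"]
    by (intro divide_right_mono) (auto simp: power2_eq_square algebra_simps)
  then have e1: "1 \<le> t * (1 + (1 + R\<^sup>2) / r)"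
    using tt mult_left_mono[of "1 + R / r" "1 + (1 + R\<^sup>2) / r" t] t by linarith
  define Z where "Z = 1 + (1 + R\<^sup>2) / r"
  have err: "s / 2 * (\<theta> * (t * R)\<^sup>2 + h + C * h * (t * R)\<^sup>2) + \<theta>
     \<le> t * (\<theta> * ((s / 2 + 1) * Z + s / 2 * (1 + C) * R\<^sup>2))"
  proof -
    have "s / 2 * (\<theta> * (t * R)\<^sup>2 + h + C * h * (t * R)\<^sup>2) + \<theta>
       \<le> s / 2 * (\<theta> * (t * R\<^sup>2) + \<theta> * (t * Z) + C * \<theta> * (t * R\<^sup>2)) + \<theta> * (t * Z)"
    proof (intro add_mono mult_left_mono)
      have "h * 1 \<le> \<theta> * (t * Z)" using h e1[folded Z_def] \<theta> by (intro mult_mono) auto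
      then show "h \<le> \<theta> * (t * Z)" by simp
      show "\<theta> \<le> \<theta> * (t * Z)" using mult_left_mono[OF e1[folded Z_def], of \<theta>] \<theta> by simp
      show "C * h * (t * R)\<^sup>2 \<le> C * \<theta> * (t * R\<^sup>2)"
        using C h \<theta> tR2 by (intro mult_mono) auto
    qed (use tR2 \<theta> s in auto)
    then show ?thesis by (simp add: field_simps)
  qed
  have h\<theta>: "t * (s / 2 * h) \<le> t * (s / 2 * \<theta>)" using t s h by (intro mult_left_mono) auto
  \<comment> \<open>Convexity along [p,x] carries the bound from x' to x.\<close>
  have "f x' \<le> (1 - t) * f p + t * f x - \<alpha> / 2 * (t * (1 - t) * R\<^sup>2)"
    using geodesically_convexD[OF f g(1), of t] g t by (simp add: x'_def R_def)
  moreover have "\<alpha> / 2 * (t * R)\<^sup>2 + \<alpha> / 2 * (t * (1 - t) * R\<^sup>2) = t * (\<alpha> / 2 * R\<^sup>2)"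
    by (simp add: field_simps power2_eq_square)
  moreover have "f p - (1 - t) * f p = t * f p" by (simp add: algebra_simps)
  ultimately have "t * f p + t * (\<alpha> / 2 * R\<^sup>2) - t * (s / (2 * h) * (R\<^sup>2 - d\<^sup>2)) - t * (s / 2 * \<theta>)
     - t * (\<theta> * ((s / 2 + 1) * (1 + (1 + R\<^sup>2) / r) + s / 2 * (1 + C) * R\<^sup>2)) \<le> t * f x"
    using near main err[unfolded Z_def] h\<theta> unfolding distrib_left[of t "s / (2 * h) * (R\<^sup>2 - d\<^sup>2)"] by linarith
  then have "t * (f p + \<alpha> / 2 * R\<^sup>2 - s / (2 * h) * (R\<^sup>2 - d\<^sup>2) - s / 2 * \<theta>
     - \<theta> * ((s / 2 + 1) * (1 + (1 + R\<^sup>2) / r) + s / 2 * (1 + C) * R\<^sup>2)) \<le> t * f x"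
    by (simp add: distrib_left right_diff_distrib mult_ac)
  then have "f p + \<alpha> / 2 * R\<^sup>2 - s / (2 * h) * (R\<^sup>2 - d\<^sup>2) - s / 2 * \<theta>
     - \<theta> * ((s / 2 + 1) * (1 + (1 + R\<^sup>2) / r) + s / 2 * (1 + C) * R\<^sup>2) \<le> f x"
    using t by (simp only: mult_le_cancel_left_pos)
  moreover have "s / 2 * \<theta> + \<theta> * ((s / 2 + 1) * (1 + (1 + R\<^sup>2) / r) + s / 2 * (1 + C) * R\<^sup>2)
     = \<theta> * ((s / 2 + (s / 2 + 1) * (1 + 1 / r)) + (s / 2 * (1 + C) + (s / 2 + 1) / r) * R\<^sup>2)"
    unfolding divide_inverse[of _ r] by (simp add: algebra_simps add_divide_distrib)
  ultimately show ?thesis by (simp add: h_def R_def C_def d_def)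
qed

text \<open>A and B are independent of \<theta>, whereas q and c depend on it. The value c = s / (2
  d(p,q)) may blow up as \<theta> tends to 0, which is harmless because its term has a favourable
  sign after integration. If no point has a positive descent rate, c = 0 and A = B = 0
  suffice.\<close>

lemma approximate_support:
  fixes f :: "'a::metric_space \<Rightarrow> real"
  assumes gs: "geodesic_space TYPE('a)"
    and curv: "curvature_bounded_below TYPE('a) \<kappa>"
    and f: "geodesically_convex \<alpha> f" and lip: "locally_lipschitz_at f p"
  obtains A B where "0 \<le> A" "0 \<le> B"
    "\<And>\<theta>. 0 < \<theta> \<Longrightarrow> \<exists>q c. 0 \<le> c \<and> (\<forall>x. f p + \<alpha> / 2 * (dist p x)\<^sup>2
        - c * ((dist p x)\<^sup>2 - (dist q x)\<^sup>2) - \<theta> * (A + B * (dist p x)\<^sup>2) \<le> f x)"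
proof (cases "\<forall>y. f p + \<alpha> / 2 * (dist p y)\<^sup>2 \<le> f y")
  case True
  then show thesis by (intro that[of 0 0]) (auto intro!: exI[of _ "0::real"])
next
  case False
  then obtain y where "f y < f p + \<alpha> / 2 * (dist p y)\<^sup>2" by (auto simp: not_le)
  from steepest_descent[OF gs f lip this] obtain s where s: "0 \<le> s"
    "\<And>y. f p - s * dist p y + \<alpha> / 2 * (dist p y)\<^sup>2 \<le> f y"
    "\<And>\<delta> r. 0 < \<delta> \<Longrightarrow> 0 < r \<Longrightarrow>
       \<exists>q. p \<noteq> q \<and> dist p q \<le> r \<and> f q \<le> f p - (s - \<delta>) * dist p q + \<alpha> / 2 * (dist p q)\<^sup>2"
    by blast
  define r where "r = (if \<kappa> > 0 then 1 / (4 * sqrt \<kappa>) else 1)"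
  have r: "0 < r" "\<kappa> > 0 \<longrightarrow> 4 * r * sqrt \<kappa> \<le> 1" by (auto simp: r_def)
  show thesis
  proof (rule that)
    fix \<theta> :: real assume \<theta>: "0 < \<theta>"
    then obtain q where "p \<noteq> q" "dist p q \<le> r" "dist p q \<le> \<theta>"
      "f q \<le> f p - (s - \<theta>\<^sup>2) * dist p q + \<alpha> / 2 * (dist p q)\<^sup>2"
      using s(3)[of "\<theta>\<^sup>2" "min r \<theta>"] r by auto
    from lower_bound_at[OF gs curv r f this(1-3) s(1) \<theta> s(2) this(4)]
    show "\<exists>q c. 0 \<le> c \<and> (\<forall>x. f p + \<alpha> / 2 * (dist p x)\<^sup>2 - c * ((dist p x)\<^sup>2 - (dist q x)\<^sup>2)
       - \<theta> * ((s / 2 + (s / 2 + 1) * (1 + 1 / r)) + (s / 2 * (1 + 4 * \<bar>\<kappa>\<bar>) + (s / 2 + 1) / r) * (dist p x)\<^sup>2) \<le> f x)"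
      using s(1) by (intro exI[of _ q] exI[of _ "s / (2 * dist p q)"]) auto
  qed (use s r in auto)
qed

section \<open>Integration against the measure\<close>

lemma P2_integrable:
  assumes "\<mu> \<in> P2"
  shows "integrable \<mu> (\<lambda>y. (dist x y)\<^sup>2)"
    and "frechet_var \<mu> x = ennreal (\<integral>y. (dist x y)\<^sup>2 \<partial>\<mu>)"
proof -
  have [measurable_cong]: "sets \<mu> = sets borel" and fin: "frechet_var \<mu> x < \<infinity>"
    using assms by (auto simp: P2_def)
  have "(\<lambda>y. (dist x y)\<^sup>2) \<in> borel_measurable borel"
    by (intro borel_measurable_continuous_onI continuous_intros)
  then have "(\<lambda>y. (dist x y)\<^sup>2) \<in> borel_measurable \<mu>" by measurable
  then show 1: "integrable \<mu> (\<lambda>y. (dist x y)\<^sup>2)"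
    using fin by (intro integrableI_bounded) (auto simp: frechet_var_def)
  show "frechet_var \<mu> x = ennreal (\<integral>y. (dist x y)\<^sup>2 \<partial>\<mu>)"
    unfolding frechet_var_def by (rule nn_integral_eq_integral[OF 1]) simp
qed

text \<open>\<open>approximate_support\<close> is integrated for fixed \<theta>, where minimality of
  the variance at p removes the term with c whatever its size; only then does \<theta> tend to
  0.\<close>

lemma jensen_barycenter:
  fixes \<mu> :: "'a::metric_space measure"
  assumes gs: "geodesic_space TYPE('a)"
    and curv: "curvature_bounded_below TYPE('a) \<kappa>"
    and \<mu>: "\<mu> \<in> P2" and bary: "barycenter \<mu> p"
    and f: "geodesically_convex \<alpha> f" and lip: "locally_lipschitz_at f p"
    and int: "integrable \<mu> f"
  shows "f p \<le> (\<integral>y. f y \<partial>\<mu>) - \<alpha> / 2 * enn2real (min_frechet_var \<mu>)"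
proof -
  interpret prob_space \<mu> using \<mu> by (simp add: P2_def)
  define V where "V q = (\<integral>y. (dist q y)\<^sup>2 \<partial>\<mu>)" for q
  have V0: "0 \<le> V q" for q unfolding V_def by (rule Bochner_Integration.integral_nonneg) simp
  note V_int = P2_integrable(1)[OF \<mu>] and V_eq = P2_integrable(2)[OF \<mu>, folded V_def]
  have min: "V p \<le> V q" for q
  proof -
    have "frechet_var \<mu> p \<le> frechet_var \<mu> q"
      using bary unfolding barycenter_def min_frechet_var_def by (simp add: INF_lower)
    then show ?thesis using V0 by (simp add: V_eq)
  qed
  have Vp: "enn2real (min_frechet_var \<mu>) = V p"
    using bary V0[of p] V_eq[of p] by (metis barycenter_def enn2real_ennreal)
  obtain A B where AB: "0 \<le> A" "0 \<le> B"
    "\<And>\<theta>. 0 < \<theta> \<Longrightarrow> \<exists>q c. 0 \<le> c \<and> (\<forall>x. f p + \<alpha> / 2 * (dist p x)\<^sup>2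
        - c * ((dist p x)\<^sup>2 - (dist q x)\<^sup>2) - \<theta> * (A + B * (dist p x)\<^sup>2) \<le> f x)"
    using approximate_support[OF gs curv f lip] by metis
  have bound: "f p + \<alpha> / 2 * V p - \<theta> * (A + B * V p) \<le> (\<integral>y. f y \<partial>\<mu>)" if \<theta>: "0 < \<theta>" for \<theta>
  proof -
    obtain q c where c: "0 \<le> c" and le: "\<And>x. f p + \<alpha> / 2 * (dist p x)\<^sup>2
        - c * ((dist p x)\<^sup>2 - (dist q x)\<^sup>2) - \<theta> * (A + B * (dist p x)\<^sup>2) \<le> f x"
      using AB(3)[OF \<theta>] by blast
    have "0 \<le> c * (V q - V p)" using c min[of q] by simp
    then have "f p + \<alpha> / 2 * V p - \<theta> * (A + B * V p)
       \<le> f p + \<alpha> / 2 * V p - c * (V p - V q) - \<theta> * (A + B * V p)"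
      by (simp add: algebra_simps)
    also have "\<dots> = (\<integral>x. f p + \<alpha> / 2 * (dist p x)\<^sup>2
        - c * ((dist p x)\<^sup>2 - (dist q x)\<^sup>2) - \<theta> * (A + B * (dist p x)\<^sup>2) \<partial>\<mu>)"
      using V_int prob_space unfolding V_def by simp
    also have "\<dots> \<le> (\<integral>y. f y \<partial>\<mu>)"
      using V_int int le by (intro integral_mono) auto
    finally show ?thesis .
  qed
  have "f p + \<alpha> / 2 * V p \<le> (\<integral>y. f y \<partial>\<mu>)"
  proof (rule field_le_epsilon)
    fix e :: real assume e: "0 < e"
    define K where "K = A + B * V p"
    have K: "0 \<le> K" using AB V0 by (simp add: K_def)
    \<comment> \<open>The denominator K + 1 instead of K covers the case K = 0.\<close>
    have "e / (K + 1) * K \<le> e" using e K by (simp add: field_simps)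
    then show "f p + \<alpha> / 2 * V p \<le> (\<integral>y. f y \<partial>\<mu>) + e"
      using bound[of "e / (K + 1)"] e K by (simp add: K_def)
  qed
  then show ?thesis by (simp add: Vp)
qed

text \<open>For nonnegative f the integral may be infinite, so that case is stated in the extended
  reals. The minimal variance is finite for a measure in \<open>P2\<close>, so
  \<open>enn2real\<close> loses nothing.\<close>

theorem theorem1p1:
  fixes \<mu> :: "'a::polish_space measure"
    and f :: "'a \<Rightarrow> real"
    and x\<^sub>0 :: 'a
    and \<kappa> \<alpha> :: real
  assumes "geodesic_space TYPE('a)"
    and "curvature_bounded_below TYPE('a) \<kappa>"
    and "\<mu> \<in> P2"
    and "barycenter \<mu> x\<^sub>0"
    and "geodesically_convex \<alpha> f"
    and "locally_lipschitz_at f x\<^sub>0"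
  shows "(integrable \<mu> f \<longrightarrow>
            f x\<^sub>0 \<le> (\<integral>y. f y \<partial>\<mu>) - \<alpha> / 2 * enn2real (min_frechet_var \<mu>))
       \<and> (f \<in> borel_measurable \<mu> \<and> (\<forall>y. 0 \<le> f y) \<longrightarrow>
            ereal (f x\<^sub>0) \<le> enn2ereal (\<integral>\<^sup>+ y. ennreal (f y) \<partial>\<mu>)
                              - ereal (\<alpha> / 2 * enn2real (min_frechet_var \<mu>)))"
proof (intro conjI impI)
  assume "integrable \<mu> f"
  with assms show "f x\<^sub>0 \<le> (\<integral>y. f y \<partial>\<mu>) - \<alpha> / 2 * enn2real (min_frechet_var \<mu>)"
    by (rule jensen_barycenter)
next
  assume f: "f \<in> borel_measurable \<mu> \<and> (\<forall>y. 0 \<le> f y)"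
  show "ereal (f x\<^sub>0) \<le> enn2ereal (\<integral>\<^sup>+ y. ennreal (f y) \<partial>\<mu>)
                              - ereal (\<alpha> / 2 * enn2real (min_frechet_var \<mu>))"
  \<comment> \<open>If the integral is infinite, so is the right side, since a real number is
    subtracted. Otherwise f is integrable and the first case applies.\<close>
  proof (cases "(\<integral>\<^sup>+ y. ennreal (f y) \<partial>\<mu>) = \<infinity>")
    case True
    then show ?thesis by simp
  next
    case False
    then have int: "integrable \<mu> f"
      using f by (intro integrableI_nonneg) (auto simp: top.not_eq_extremum)
    have "(\<integral>\<^sup>+ y. ennreal (f y) \<partial>\<mu>) = ennreal (\<integral>y. f y \<partial>\<mu>)"
      using int f by (intro nn_integral_eq_integral) auto
    moreover have "0 \<le> (\<integral>y. f y \<partial>\<mu>)" using f by (intro Bochner_Integration.integral_nonneg) auto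
    ultimately show ?thesis using jensen_barycenter[OF assms int] by (simp add: enn2ereal_ennreal)
  qed
qed

end
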